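(* Let $\mathcal{C}$ and $\mathcal{X}$ be categories with finite limits and finite colimits, and let $F:\mathcal{C}\to\mathcal{X}$ be a faithful essential localization such that every pullback stable essential monomorphism in $\mathcal{X}$ is an isomorphism. Then $F$ factors uniquely through the canonical functor $\mathcal{C}\to\mathrm{Spec}(\mathcal{C})$, and the resulting functor $\bar{F}:\mathrm{Spec}(\mathcal{C})\to\mathcal{X}$ is a category equivalence.
   Context: A localization of $\mathcal{C}$ is an adjunction $(F,G,\eta,\varepsilon):\mathcal{C}\to\mathcal{X}$ ($F$ left adjoint to $G$, unit $\eta:1_{\mathcal{C}}\to GF$, counit $\varepsilon:FG\to 1_{\mathcal{X}}$) in which $F:\mathcal{C}\to\mathcal{X}$ preserves finite limits and $G:\mathcal{X}\to\mathcal{C}$ is fully faithful; one refers to it simply as $F$. It is faithful if the functor $F$ is faithful, and essential if $F$ also has a left adjoint. A monomorphism $m:S\to A$ in a category is an essential monomorphism if every morphism $f:A\to B$ for which $fm$ is a monomorphism is itself a monomorphism. It is a pullback stable essential monomorphism if, for every morphism $u:X\to A$, the pullback projection $S\times_A X\to X$ of $m$ along $u$ is an essential monomorphism. The spectral category $\mathrm{Spec}(\mathcal{C})$ is the category of fractions $\mathcal{C}[\Sigma^{-1}]$, where $\Sigma$ is the class of all pullback stable essential monomorphisms of $\mathcal{C}$; it comes with the canonical functor $\mathcal{C}\to\mathrm{Spec}(\mathcal{C})$, universal among functors out of $\mathcal{C}$ sending all elements of $\Sigma$ to isomorphisms. *)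

theory Defs
  imports Main
begin

section \<open>Categories, functors, natural transformations\<close>

record ('o, 'm) cat =
  Obj :: "'o set"
  Mor :: "'m set"
  Dom :: "'m \<Rightarrow> 'o"
  Cod :: "'m \<Rightarrow> 'o"
  Ident :: "'o \<Rightarrow> 'm"
  Comp :: "'m \<Rightarrow> 'm \<Rightarrow> 'm"  (infixl "\<cdot>\<index>" 70)

definition hom :: "('o, 'm) cat \<Rightarrow> 'o \<Rightarrow> 'o \<Rightarrow> 'm set" where
  "hom C a b = {f \<in> Mor C. Dom C f = a \<and> Cod C f = b}"

text \<open>Composition is written in the usual order and is only constrained on composable pairs.\<close>

locale category =
  fixes C :: "('o, 'm) cat" (structure)
  assumes dom_in [simp, intro]: "f \<in> Mor C \<Longrightarrow> Dom C f \<in> Obj C"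
    and cod_in [simp, intro]: "f \<in> Mor C \<Longrightarrow> Cod C f \<in> Obj C"
    and ident_in: "a \<in> Obj C \<Longrightarrow> Ident C a \<in> hom C a a"
    and comp_in: "f \<in> hom C a b \<Longrightarrow> g \<in> hom C b c \<Longrightarrow> g \<cdot> f \<in> hom C a c"
    and ident_left: "f \<in> hom C a b \<Longrightarrow> Ident C b \<cdot> f = f"
    and ident_right: "f \<in> hom C a b \<Longrightarrow> f \<cdot> Ident C a = f"
    and comp_assoc: "f \<in> hom C a b \<Longrightarrow> g \<in> hom C b c \<Longrightarrow> h \<in> hom C c d
                      \<Longrightarrow> (h \<cdot> g) \<cdot> f = h \<cdot> (g \<cdot> f)"

definition op_cat :: "('o, 'm) cat \<Rightarrow> ('o, 'm) cat" where
  "op_cat C = \<lparr>Obj = Obj C, Mor = Mor C, Dom = Cod C, Cod = Dom C, Ident = Ident C,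
               Comp = (\<lambda>g f. f \<cdot>\<^bsub>C\<^esub> g)\<rparr>"

record ('o, 'm, 'p, 'n) ftor =
  ob_map :: "'o \<Rightarrow> 'p"
  mor_map :: "'m \<Rightarrow> 'n"

locale cat_functor = source: category C + target: category D
  for C :: "('o, 'm) cat" and D :: "('p, 'n) cat" +
  fixes F :: "('o, 'm, 'p, 'n) ftor"
  assumes ob_in: "a \<in> Obj C \<Longrightarrow> ob_map F a \<in> Obj D"
    and mor_in: "f \<in> hom C a b \<Longrightarrow> mor_map F f \<in> hom D (ob_map F a) (ob_map F b)"
    and map_ident: "a \<in> Obj C \<Longrightarrow> mor_map F (Ident C a) = Ident D (ob_map F a)"
    and map_comp: "f \<in> hom C a b \<Longrightarrow> g \<in> hom C b c
                    \<Longrightarrow> mor_map F (g \<cdot>\<^bsub>C\<^esub> f) = mor_map F g \<cdot>\<^bsub>D\<^esub> mor_map F f"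

text \<open>Functors are total HOL functions whose values off the carrier of the source are junk;
  equality of functors is therefore agreement on the objects and morphisms of the source.\<close>

definition ftor_eq ::
  "('o, 'm) cat \<Rightarrow> ('o, 'm, 'p, 'n) ftor \<Rightarrow> ('o, 'm, 'p, 'n) ftor \<Rightarrow> bool" where
  "ftor_eq C F G \<longleftrightarrow> (\<forall>a\<in>Obj C. ob_map F a = ob_map G a) \<and> (\<forall>f\<in>Mor C. mor_map F f = mor_map G f)"

definition id_ftor :: "('o, 'm, 'o, 'm) ftor" where
  "id_ftor = \<lparr>ob_map = (\<lambda>a. a), mor_map = (\<lambda>f. f)\<rparr>"

definition comp_ftor ::
  "('p, 'n, 'q, 'k) ftor \<Rightarrow> ('o, 'm, 'p, 'n) ftor \<Rightarrow> ('o, 'm, 'q, 'k) ftor" (infixl "\<circ>\<^sub>F" 55) where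
  "G \<circ>\<^sub>F F = \<lparr>ob_map = ob_map G \<circ> ob_map F, mor_map = mor_map G \<circ> mor_map F\<rparr>"

definition faithful ::
  "('o, 'm) cat \<Rightarrow> ('p, 'n) cat \<Rightarrow> ('o, 'm, 'p, 'n) ftor \<Rightarrow> bool" where
  "faithful C D F \<longleftrightarrow> (\<forall>a\<in>Obj C. \<forall>b\<in>Obj C. inj_on (mor_map F) (hom C a b))"

definition fully_faithful ::
  "('o, 'm) cat \<Rightarrow> ('p, 'n) cat \<Rightarrow> ('o, 'm, 'p, 'n) ftor \<Rightarrow> bool" where
  "fully_faithful C D F \<longleftrightarrow>
     (\<forall>a\<in>Obj C. \<forall>b\<in>Obj C. bij_betw (mor_map F) (hom C a b) (hom D (ob_map F a) (ob_map F b)))"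

definition is_iso :: "('o, 'm) cat \<Rightarrow> 'm \<Rightarrow> bool" where
  "is_iso C f \<longleftrightarrow> f \<in> Mor C \<and>
     (\<exists>g \<in> hom C (Cod C f) (Dom C f). g \<cdot>\<^bsub>C\<^esub> f = Ident C (Dom C f) \<and> f \<cdot>\<^bsub>C\<^esub> g = Ident C (Cod C f))"

definition nat_trans ::
  "('o, 'm) cat \<Rightarrow> ('p, 'n) cat \<Rightarrow> ('o, 'm, 'p, 'n) ftor \<Rightarrow> ('o, 'm, 'p, 'n) ftor
    \<Rightarrow> ('o \<Rightarrow> 'n) \<Rightarrow> bool" where
  "nat_trans C D F G \<tau> \<longleftrightarrow> cat_functor C D F \<and> cat_functor C D G \<and>
     (\<forall>a\<in>Obj C. \<tau> a \<in> hom D (ob_map F a) (ob_map G a)) \<and>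
     (\<forall>f\<in>Mor C. \<tau> (Cod C f) \<cdot>\<^bsub>D\<^esub> mor_map F f = mor_map G f \<cdot>\<^bsub>D\<^esub> \<tau> (Dom C f))"

definition nat_iso ::
  "('o, 'm) cat \<Rightarrow> ('p, 'n) cat \<Rightarrow> ('o, 'm, 'p, 'n) ftor \<Rightarrow> ('o, 'm, 'p, 'n) ftor
    \<Rightarrow> ('o \<Rightarrow> 'n) \<Rightarrow> bool" where
  "nat_iso C D F G \<tau> \<longleftrightarrow> nat_trans C D F G \<tau> \<and> (\<forall>a\<in>Obj C. is_iso D (\<tau> a))"

definition equivalence ::
  "('o, 'm) cat \<Rightarrow> ('p, 'n) cat \<Rightarrow> ('o, 'm, 'p, 'n) ftor \<Rightarrow> bool" where
  "equivalence C D F \<longleftrightarrow> cat_functor C D F \<and>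
     (\<exists>G \<eta> \<epsilon>. cat_functor D C G \<and> nat_iso C C id_ftor (G \<circ>\<^sub>F F) \<eta> \<and> nat_iso D D (F \<circ>\<^sub>F G) id_ftor \<epsilon>)"

definition adjunction ::
  "('o, 'm) cat \<Rightarrow> ('p, 'n) cat \<Rightarrow> ('o, 'm, 'p, 'n) ftor \<Rightarrow> ('p, 'n, 'o, 'm) ftor
    \<Rightarrow> ('o \<Rightarrow> 'm) \<Rightarrow> ('p \<Rightarrow> 'n) \<Rightarrow> bool" where
  "adjunction C X F G \<eta> \<epsilon> \<longleftrightarrow> cat_functor C X F \<and> cat_functor X C G \<and>
     nat_trans C C id_ftor (G \<circ>\<^sub>F F) \<eta> \<and> nat_trans X X (F \<circ>\<^sub>F G) id_ftor \<epsilon> \<and>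
     (\<forall>a\<in>Obj C. \<epsilon> (ob_map F a) \<cdot>\<^bsub>X\<^esub> mor_map F (\<eta> a) = Ident X (ob_map F a)) \<and>
     (\<forall>x\<in>Obj X. mor_map G (\<epsilon> x) \<cdot>\<^bsub>C\<^esub> \<eta> (ob_map G x) = Ident C (ob_map G x))"


section \<open>Finite limits and colimits\<close>

definition cone ::
  "('i, 'e) cat \<Rightarrow> ('o, 'm) cat \<Rightarrow> ('i, 'e, 'o, 'm) ftor \<Rightarrow> 'o \<Rightarrow> ('i \<Rightarrow> 'm) \<Rightarrow> bool" where
  "cone J C D l \<pi> \<longleftrightarrow> l \<in> Obj C \<and> (\<forall>j\<in>Obj J. \<pi> j \<in> hom C l (ob_map D j)) \<and>
     (\<forall>u\<in>Mor J. mor_map D u \<cdot>\<^bsub>C\<^esub> \<pi> (Dom J u) = \<pi> (Cod J u))"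

definition limit_cone ::
  "('i, 'e) cat \<Rightarrow> ('o, 'm) cat \<Rightarrow> ('i, 'e, 'o, 'm) ftor \<Rightarrow> 'o \<Rightarrow> ('i \<Rightarrow> 'm) \<Rightarrow> bool" where
  "limit_cone J C D l \<pi> \<longleftrightarrow> cone J C D l \<pi> \<and>
     (\<forall>k \<kappa>. cone J C D k \<kappa> \<longrightarrow> (\<exists>!h. h \<in> hom C k l \<and> (\<forall>j\<in>Obj J. \<pi> j \<cdot>\<^bsub>C\<^esub> h = \<kappa> j)))"

definition finite_category :: "('i, 'e) cat \<Rightarrow> bool" where
  "finite_category J \<longleftrightarrow> category J \<and> finite (Obj J) \<and> finite (Mor J)"

text \<open>HOL cannot quantify over the type of the index category inside a formula. Every finite
  category is isomorphic to one whose objects and morphisms are natural numbers, so the index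
  categories below range over all finite categories up to isomorphism. As they are closed under
  passing to opposites, finite limits in the opposite category are finite colimits.\<close>

definition has_finite_limits :: "('o, 'm) cat \<Rightarrow> bool" where
  "has_finite_limits C \<longleftrightarrow> (\<forall>(J :: (nat, nat) cat) D. finite_category J \<and> cat_functor J C D
     \<longrightarrow> (\<exists>l \<pi>. limit_cone J C D l \<pi>))"

definition has_finite_colimits :: "('o, 'm) cat \<Rightarrow> bool" where
  "has_finite_colimits C \<longleftrightarrow> has_finite_limits (op_cat C)"

definition preserves_finite_limits ::
  "('o, 'm) cat \<Rightarrow> ('p, 'n) cat \<Rightarrow> ('o, 'm, 'p, 'n) ftor \<Rightarrow> bool" where
  "preserves_finite_limits C X F \<longleftrightarrow>
     (\<forall>(J :: (nat, nat) cat) D l \<pi>. finite_category J \<and> cat_functor J C D \<and> limit_cone J C D l \<pi>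
        \<longrightarrow> limit_cone J X (F \<circ>\<^sub>F D) (ob_map F l) (mor_map F \<circ> \<pi>))"


section \<open>Localizations\<close>

definition localization ::
  "('o, 'm) cat \<Rightarrow> ('p, 'n) cat \<Rightarrow> ('o, 'm, 'p, 'n) ftor \<Rightarrow> ('p, 'n, 'o, 'm) ftor
    \<Rightarrow> ('o \<Rightarrow> 'm) \<Rightarrow> ('p \<Rightarrow> 'n) \<Rightarrow> bool" where
  "localization C X F G \<eta> \<epsilon> \<longleftrightarrow>
     adjunction C X F G \<eta> \<epsilon> \<and> preserves_finite_limits C X F \<and> fully_faithful X C G"

definition has_left_adjoint ::
  "('o, 'm) cat \<Rightarrow> ('p, 'n) cat \<Rightarrow> ('o, 'm, 'p, 'n) ftor \<Rightarrow> bool" where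
  "has_left_adjoint C X F \<longleftrightarrow> (\<exists>L \<eta> \<epsilon>. adjunction X C L F \<eta> \<epsilon>)"


section \<open>Essential monomorphisms\<close>

definition is_mono :: "('o, 'm) cat \<Rightarrow> 'm \<Rightarrow> bool" where
  "is_mono C m \<longleftrightarrow> m \<in> Mor C \<and>
     (\<forall>x\<in>Obj C. \<forall>f \<in> hom C x (Dom C m). \<forall>g \<in> hom C x (Dom C m). m \<cdot>\<^bsub>C\<^esub> f = m \<cdot>\<^bsub>C\<^esub> g \<longrightarrow> f = g)"

definition essential_mono :: "('o, 'm) cat \<Rightarrow> 'm \<Rightarrow> bool" where
  "essential_mono C m \<longleftrightarrow> is_mono C m \<and>
     (\<forall>f\<in>Mor C. Dom C f = Cod C m \<and> is_mono C (f \<cdot>\<^bsub>C\<^esub> m) \<longrightarrow> is_mono C f)"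

text \<open>\<open>pullback C f g p q\<close>: the span \<open>(p, q)\<close> is a pullback of the cospan \<open>(f, g)\<close>, so that
  \<open>q\<close> is the projection of \<open>f\<close> along \<open>g\<close>.\<close>

definition pullback :: "('o, 'm) cat \<Rightarrow> 'm \<Rightarrow> 'm \<Rightarrow> 'm \<Rightarrow> 'm \<Rightarrow> bool" where
  "pullback C f g p q \<longleftrightarrow>
     f \<in> Mor C \<and> g \<in> Mor C \<and> p \<in> Mor C \<and> q \<in> Mor C \<and>
     Cod C f = Cod C g \<and> Dom C p = Dom C q \<and> Cod C p = Dom C f \<and> Cod C q = Dom C g \<and>
     f \<cdot>\<^bsub>C\<^esub> p = g \<cdot>\<^bsub>C\<^esub> q \<and>
     (\<forall>x\<in>Obj C. \<forall>p' \<in> hom C x (Dom C f). \<forall>q' \<in> hom C x (Dom C g). f \<cdot>\<^bsub>C\<^esub> p' = g \<cdot>\<^bsub>C\<^esub> q' \<longrightarrow>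
        (\<exists>!h. h \<in> hom C x (Dom C p) \<and> p \<cdot>\<^bsub>C\<^esub> h = p' \<and> q \<cdot>\<^bsub>C\<^esub> h = q'))"

definition pb_stable_essential_mono :: "('o, 'm) cat \<Rightarrow> 'm \<Rightarrow> bool" where
  "pb_stable_essential_mono C m \<longleftrightarrow> essential_mono C m \<and>
     (\<forall>u p q. pullback C m u p q \<longrightarrow> essential_mono C q)"


section \<open>Categories of fractions\<close>

text \<open>The construction of Gabriel and Zisman: a morphism \<open>a \<rightarrow> b\<close> of the category of fractions is a
  zigzag of morphisms of \<open>C\<close> and formal inverses of members of \<open>S\<close>, modulo the least congruence
  that makes \<open>C \<rightarrow> C[S\<inverse>]\<close> a functor and the formal inverses inverse. A zigzag is listed in the
  order in which it is traversed, and \<open>Bwd s\<close> is traversed from the codomain of \<open>s\<close> to its domain.\<close>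

datatype 'm step = Fwd 'm | Bwd 'm

primrec zigzag :: "('o, 'm) cat \<Rightarrow> 'm set \<Rightarrow> 'o \<Rightarrow> 'm step list \<Rightarrow> 'o \<Rightarrow> bool" where
  "zigzag C S a [] b \<longleftrightarrow> a \<in> Obj C \<and> a = b"
| "zigzag C S a (x # p) b \<longleftrightarrow> (case x of
       Fwd f \<Rightarrow> f \<in> Mor C \<and> Dom C f = a \<and> zigzag C S (Cod C f) p b
     | Bwd s \<Rightarrow> s \<in> S \<and> Cod C s = a \<and> zigzag C S (Dom C s) p b)"

inductive zigzag_eq ::
  "('o, 'm) cat \<Rightarrow> 'm set \<Rightarrow> 'o \<Rightarrow> 'o \<Rightarrow> 'm step list \<Rightarrow> 'm step list \<Rightarrow> bool"
  for C :: "('o, 'm) cat" and S :: "'m set" where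
  refl: "zigzag C S a p b \<Longrightarrow> zigzag_eq C S a b p p"
| sym: "zigzag_eq C S a b p q \<Longrightarrow> zigzag_eq C S a b q p"
| trans: "zigzag_eq C S a b p q \<Longrightarrow> zigzag_eq C S a b q r \<Longrightarrow> zigzag_eq C S a b p r"
| append: "zigzag_eq C S a b p q \<Longrightarrow> zigzag_eq C S b c p' q' \<Longrightarrow> zigzag_eq C S a c (p @ p') (q @ q')"
| ident: "a \<in> Obj C \<Longrightarrow> zigzag_eq C S a a [Fwd (Ident C a)] []"
| comp: "f \<in> hom C a b \<Longrightarrow> g \<in> hom C b c \<Longrightarrow> zigzag_eq C S a c [Fwd f, Fwd g] [Fwd (g \<cdot>\<^bsub>C\<^esub> f)]"
| inv_right: "s \<in> S \<Longrightarrow> zigzag_eq C S (Dom C s) (Dom C s) [Fwd s, Bwd s] []"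
| inv_left: "s \<in> S \<Longrightarrow> zigzag_eq C S (Cod C s) (Cod C s) [Bwd s, Fwd s] []"

text \<open>Morphisms of the category of fractions: a class of zigzags together with its endpoints.\<close>

definition zigzag_class ::
  "('o, 'm) cat \<Rightarrow> 'm set \<Rightarrow> 'o \<Rightarrow> 'm step list \<Rightarrow> 'o \<Rightarrow> 'o \<times> 'm step list set \<times> 'o" where
  "zigzag_class C S a p b = (a, {q. zigzag_eq C S a b p q}, b)"

definition fractions ::
  "('o, 'm) cat \<Rightarrow> 'm set \<Rightarrow> ('o, 'o \<times> 'm step list set \<times> 'o) cat" where
  "fractions C S = \<lparr>
     Obj = Obj C,
     Mor = {zigzag_class C S a p b | a p b. zigzag C S a p b},
     Dom = (\<lambda>(a, P, b). a),
     Cod = (\<lambda>(a, P, b). b),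
     Ident = (\<lambda>a. zigzag_class C S a [] a),
     Comp = (\<lambda>(b', Q, c) (a, P, b). (a, {r. \<exists>p\<in>P. \<exists>q\<in>Q. zigzag_eq C S a c (p @ q) r}, c))\<rparr>"

definition fractions_ftor ::
  "('o, 'm) cat \<Rightarrow> 'm set \<Rightarrow> ('o, 'm, 'o, 'o \<times> 'm step list set \<times> 'o) ftor" where
  "fractions_ftor C S =
     \<lparr>ob_map = (\<lambda>a. a), mor_map = (\<lambda>f. zigzag_class C S (Dom C f) [Fwd f] (Cod C f))\<rparr>"

definition Spec :: "('o, 'm) cat \<Rightarrow> ('o, 'o \<times> 'm step list set \<times> 'o) cat" where
  "Spec C = fractions C {m. pb_stable_essential_mono C m}"

definition Spec_ftor :: "('o, 'm) cat \<Rightarrow> ('o, 'm, 'o, 'o \<times> 'm step list set \<times> 'o) ftor" where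
  "Spec_ftor C = fractions_ftor C {m. pb_stable_essential_mono C m}"


subsection \<open>The universal property\<close>

locale fractions_setup = category C for C :: "('o, 'm) cat" (structure) +
  fixes S :: "'m set"
  assumes S_sub: "S \<subseteq> Mor C"
begin

abbreviation "Q \<equiv> fractions C S"
abbreviation "L \<equiv> fractions_ftor C S"
abbreviation "cls \<equiv> zigzag_class C S"

lemma S_mor [simp, intro]: "s \<in> S \<Longrightarrow> s \<in> Mor C"
  using S_sub by auto

lemma hom_self: "f \<in> Mor C \<Longrightarrow> f \<in> hom C (Dom C f) (Cod C f)"
  by (simp add: hom_def)

lemma zigzag_append:
  "zigzag C S a p b \<Longrightarrow> zigzag C S b q c \<Longrightarrow> zigzag C S a (p @ q) c"
  by (induction p arbitrary: a) (auto split: step.splits)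

lemma zigzag_end: "zigzag C S a p b \<Longrightarrow> a \<in> Obj C \<and> b \<in> Obj C"
  by (induction p arbitrary: a) (auto split: step.splits)

lemma zigzag_eq_zigzag:
  "zigzag_eq C S a b p q \<Longrightarrow> zigzag C S a p b \<and> zigzag C S a q b"
proof (induction rule: zigzag_eq.induct)
  case (ident a)
  then show ?case using ident_in[of a] by (auto simp: hom_def)
next
  case (comp f a b g c)
  then show ?case using comp_in[of f a b g c] by (auto simp: hom_def)
qed (auto intro: zigzag_append)

lemma cls_eq_iff:
  assumes "zigzag C S a p b"
  shows "cls a p b = cls a q b \<longleftrightarrow> zigzag_eq C S a b p q"
proof
  assume "cls a p b = cls a q b"
  then have "zigzag_eq C S a b q p"
    using zigzag_eq.refl[OF assms] by (auto simp: zigzag_class_def)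
  then show "zigzag_eq C S a b p q" by (rule zigzag_eq.sym)
next
  assume "zigzag_eq C S a b p q"
  then show "cls a p b = cls a q b"
    unfolding zigzag_class_def by (auto intro: zigzag_eq.trans zigzag_eq.sym)
qed

lemma comp_cls:
  assumes "zigzag C S a p b" "zigzag C S b q c"
  shows "cls b q c \<cdot>\<^bsub>Q\<^esub> cls a p b = cls a (p @ q) c"
  using assms zigzag_eq.refl[OF assms(1)] zigzag_eq.refl[OF assms(2)]
  by (auto simp: fractions_def zigzag_class_def intro: zigzag_eq.trans zigzag_eq.append)

lemma hom_Q: "f \<in> hom Q a b \<longleftrightarrow> (\<exists>p. zigzag C S a p b \<and> f = cls a p b)"
  by (auto simp: hom_def fractions_def zigzag_class_def)

lemma cls_hom: "zigzag C S a p b \<Longrightarrow> cls a p b \<in> hom Q a b"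
  by (auto simp: hom_Q)

lemma Obj_Q [simp]: "Obj Q = Obj C"
  by (simp add: fractions_def)

lemma Ident_Q: "Ident Q a = cls a [] a"
  by (simp add: fractions_def)

lemma Mor_Q: "f \<in> Mor Q \<longleftrightarrow> (\<exists>a p b. zigzag C S a p b \<and> f = cls a p b)"
  by (auto simp: fractions_def)

lemma Dom_Q [simp]: "Dom Q (cls a p b) = a" and Cod_Q [simp]: "Cod Q (cls a p b) = b"
  by (simp_all add: fractions_def zigzag_class_def)

theorem category_fractions: "category Q"
proof
  fix f assume "f \<in> Mor Q"
  then show "Dom Q f \<in> Obj Q" "Cod Q f \<in> Obj Q"
    using zigzag_end by (auto simp: Mor_Q)
next
  fix a assume "a \<in> Obj Q"
  then show "Ident Q a \<in> hom Q a a" by (auto simp: hom_Q Ident_Q intro!: exI[of _ "[]"])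
next
  fix f g a b c assume "f \<in> hom Q a b" "g \<in> hom Q b c"
  then show "g \<cdot>\<^bsub>Q\<^esub> f \<in> hom Q a c"
    by (auto simp: hom_Q comp_cls intro: zigzag_append)
next
  fix f a b assume "f \<in> hom Q a b"
  then obtain p where p: "zigzag C S a p b" "f = cls a p b" by (auto simp: hom_Q)
  then have z: "zigzag C S a [] a" "zigzag C S b [] b" using zigzag_end by auto
  show "Ident Q b \<cdot>\<^bsub>Q\<^esub> f = f" "f \<cdot>\<^bsub>Q\<^esub> Ident Q a = f"
    using comp_cls[OF p(1) z(2)] comp_cls[OF z(1) p(1)] p(2) by (simp_all add: Ident_Q)
next
  fix f g h a b c d assume "f \<in> hom Q a b" "g \<in> hom Q b c" "h \<in> hom Q c d"
  then obtain p q r where "zigzag C S a p b" "f = cls a p b" "zigzag C S b q c" "g = cls b q c"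
    "zigzag C S c r d" "h = cls c r d"
    by (auto simp: hom_Q)
  then show "h \<cdot>\<^bsub>Q\<^esub> g \<cdot>\<^bsub>Q\<^esub> f = h \<cdot>\<^bsub>Q\<^esub> (g \<cdot>\<^bsub>Q\<^esub> f)"
    by (simp add: comp_cls zigzag_append)
qed

lemma L_mor: "f \<in> hom C a b \<Longrightarrow> mor_map L f = cls a [Fwd f] b"
  by (auto simp: hom_def fractions_ftor_def)

lemma L_ob [simp]: "ob_map L a = a"
  by (simp add: fractions_ftor_def)

lemma zigzag_Fwd: "f \<in> hom C a b \<Longrightarrow> zigzag C S a [Fwd f] b"
  by (auto simp: hom_def)

lemma zigzag_Bwd: "s \<in> S \<Longrightarrow> s \<in> hom C a b \<Longrightarrow> zigzag C S b [Bwd s] a"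
  by (auto simp: hom_def)

theorem functor_fractions: "cat_functor C Q L"
proof (intro cat_functor.intro cat_functor_axioms.intro category_axioms category_fractions)
  fix a assume "a \<in> Obj C"
  then show "ob_map L a \<in> Obj Q" by simp
next
  fix f a b assume f: "f \<in> hom C a b"
  show "mor_map L f \<in> hom Q (ob_map L a) (ob_map L b)"
    using cls_hom[OF zigzag_Fwd[OF f]] by (simp add: L_mor[OF f])
next
  fix a assume a: "a \<in> Obj C"
  show "mor_map L (Ident C a) = Ident Q (ob_map L a)"
    using zigzag_eq.ident[OF a, where S = S] zigzag_Fwd[OF ident_in[OF a]]
    by (simp add: L_mor[OF ident_in[OF a]] Ident_Q cls_eq_iff del: zigzag.simps)
next
  fix f g a b c assume f: "f \<in> hom C a b" and g: "g \<in> hom C b c"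
  have "cls a ([Fwd f] @ [Fwd g]) c = cls a [Fwd (g \<cdot> f)] c"
    using zigzag_eq.comp[OF f g, where S = S] zigzag_append[OF zigzag_Fwd[OF f] zigzag_Fwd[OF g]]
    by (simp add: cls_eq_iff del: zigzag.simps)
  then show "mor_map L (g \<cdot> f) = mor_map L g \<cdot>\<^bsub>Q\<^esub> mor_map L f"
    by (simp add: L_mor[OF f] L_mor[OF g] L_mor[OF comp_in[OF f g]]
        comp_cls[OF zigzag_Fwd[OF f] zigzag_Fwd[OF g]])
qed

lemma inverse_cls:
  assumes "s \<in> S" "s \<in> hom C a b"
  shows "cls b [Bwd s] a \<cdot>\<^bsub>Q\<^esub> mor_map L s = Ident Q a"
    and "mor_map L s \<cdot>\<^bsub>Q\<^esub> cls b [Bwd s] a = Ident Q b"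
proof -
  have z: "zigzag C S a [Fwd s] b" "zigzag C S b [Bwd s] a"
    using assms zigzag_Fwd zigzag_Bwd by auto
  have e: "zigzag_eq C S a a [Fwd s, Bwd s] []" "zigzag_eq C S b b [Bwd s, Fwd s] []"
    using zigzag_eq.inv_right[OF assms(1), of C] zigzag_eq.inv_left[OF assms(1), of C] assms(2)
    by (auto simp: hom_def)
  show "cls b [Bwd s] a \<cdot>\<^bsub>Q\<^esub> mor_map L s = Ident Q a"
    using zigzag_append[OF z] comp_cls[OF z] e(1)
    by (simp add: L_mor[OF assms(2)] Ident_Q cls_eq_iff del: zigzag.simps)
  show "mor_map L s \<cdot>\<^bsub>Q\<^esub> cls b [Bwd s] a = Ident Q b"
    using zigzag_append[OF z(2,1)] comp_cls[OF z(2,1)] e(2)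
    by (simp add: L_mor[OF assms(2)] Ident_Q cls_eq_iff del: zigzag.simps)
qed

theorem iso_fractions:
  assumes s: "s \<in> S"
  shows "is_iso Q (mor_map L s)"
proof -
  let ?a = "Dom C s" and ?b = "Cod C s"
  have h: "s \<in> hom C ?a ?b" using s by (simp add: hom_def)
  have "cls ?b [Bwd s] ?a \<in> hom Q ?b ?a" by (rule cls_hom[OF zigzag_Bwd[OF s h]])
  moreover have "mor_map L s \<in> Mor Q"
    using cls_hom[OF zigzag_Fwd[OF h]] by (simp add: L_mor[OF h] hom_def)
  moreover have "Dom Q (mor_map L s) = ?a" "Cod Q (mor_map L s) = ?b"
    by (simp_all add: L_mor[OF h])
  ultimately show ?thesis
    using inverse_cls[OF s h] by (auto simp: is_iso_def)
qed

end

lemma (in category) inverse_unique: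
  assumes "f \<in> hom C a b" "g \<in> hom C b a" "h \<in> hom C b a"
    "g \<cdot> f = Ident C a" "f \<cdot> h = Ident C b"
  shows "g = h"
  using comp_assoc[OF assms(3,1,2)] assms(4,5) ident_left[OF assms(3)] ident_right[OF assms(2)]
  by simp

definition inverse_mor :: "('o, 'm) cat \<Rightarrow> 'm \<Rightarrow> 'm" where
  "inverse_mor C f = (SOME g. g \<in> hom C (Cod C f) (Dom C f) \<and>
     g \<cdot>\<^bsub>C\<^esub> f = Ident C (Dom C f) \<and> f \<cdot>\<^bsub>C\<^esub> g = Ident C (Cod C f))"

lemma inverse_mor:
  assumes "is_iso C f" "f \<in> hom C a b"
  shows "inverse_mor C f \<in> hom C b a" "inverse_mor C f \<cdot>\<^bsub>C\<^esub> f = Ident C a"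
    "f \<cdot>\<^bsub>C\<^esub> inverse_mor C f = Ident C b"
proof -
  have "inverse_mor C f \<in> hom C (Cod C f) (Dom C f) \<and>
     inverse_mor C f \<cdot>\<^bsub>C\<^esub> f = Ident C (Dom C f) \<and> f \<cdot>\<^bsub>C\<^esub> inverse_mor C f = Ident C (Cod C f)"
    unfolding inverse_mor_def by (rule someI_ex) (use assms in \<open>auto simp: is_iso_def\<close>)
  then show "inverse_mor C f \<in> hom C b a" "inverse_mor C f \<cdot>\<^bsub>C\<^esub> f = Ident C a"
    "f \<cdot>\<^bsub>C\<^esub> inverse_mor C f = Ident C b"
    using assms(2) by (auto simp: hom_def)
qed

locale inverting_functor = fractions_setup C S + cat_functor C D F
  for C :: "('o, 'm) cat" and S and D :: "('p, 'n) cat" and F +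
  assumes inverts: "s \<in> S \<Longrightarrow> is_iso D (mor_map F s)"
begin

primrec zeval :: "'o \<Rightarrow> 'm step list \<Rightarrow> 'n" where
  "zeval a [] = Ident D (ob_map F a)"
| "zeval a (x # p) = (case x of
       Fwd f \<Rightarrow> zeval (Cod C f) p \<cdot>\<^bsub>D\<^esub> mor_map F f
     | Bwd s \<Rightarrow> zeval (Dom C s) p \<cdot>\<^bsub>D\<^esub> inverse_mor D (mor_map F s))"

lemma F_self: "f \<in> Mor C \<Longrightarrow> mor_map F f \<in> hom D (ob_map F (Dom C f)) (ob_map F (Cod C f))"
  by (rule mor_in) (simp add: hom_def)

lemma inv_self:
  "s \<in> S \<Longrightarrow> inverse_mor D (mor_map F s) \<in> hom D (ob_map F (Cod C s)) (ob_map F (Dom C s))"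
  by (rule inverse_mor(1)[OF inverts F_self]) auto

lemma zeval_in: "zigzag C S a p b \<Longrightarrow> zeval a p \<in> hom D (ob_map F a) (ob_map F b)"
  by (induction p arbitrary: a)
     (auto split: step.splits intro: target.ident_in ob_in target.comp_in[OF F_self]
        target.comp_in[OF inv_self])

lemma zeval_append:
  "zigzag C S a p b \<Longrightarrow> zigzag C S b q c \<Longrightarrow> zeval a (p @ q) = zeval b q \<cdot>\<^bsub>D\<^esub> zeval a p"
proof (induction p arbitrary: a)
  case Nil
  then show ?case using target.ident_right[OF zeval_in[OF Nil(2)]] by auto
next
  case (Cons x p)
  show ?case
  proof (cases x)
    case (Fwd f)
    then have f: "f \<in> Mor C" "Dom C f = a" "zigzag C S (Cod C f) p b" using Cons.prems by auto
    show ?thesis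
      using Cons.IH[OF f(3) Cons.prems(2)]
        target.comp_assoc[OF F_self[OF f(1)] zeval_in[OF f(3)] zeval_in[OF Cons.prems(2)]] Fwd
      by simp
  next
    case (Bwd s)
    then have s: "s \<in> S" "Cod C s = a" "zigzag C S (Dom C s) p b" using Cons.prems by auto
    show ?thesis
      using Cons.IH[OF s(3) Cons.prems(2)]
        target.comp_assoc[OF inv_self[OF s(1)] zeval_in[OF s(3)] zeval_in[OF Cons.prems(2)]] Bwd
      by simp
  qed
qed

lemma zeval_Fwd: "f \<in> hom C a b \<Longrightarrow> zeval a [Fwd f] = mor_map F f"
  using target.ident_left[OF mor_in, of f a b] by (auto simp: hom_def)

lemma zeval_Bwd: "s \<in> S \<Longrightarrow> zeval (Cod C s) [Bwd s] = inverse_mor D (mor_map F s)"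
  using target.ident_left[OF inv_self, of s] by simp

lemma zeval_cong: "zigzag_eq C S a b p q \<Longrightarrow> zeval a p = zeval a q"
proof (induction rule: zigzag_eq.induct)
  case (append a b p q c p' q')
  then show ?case using zigzag_eq_zigzag by (metis zeval_append)
next
  case (ident a)
  then show ?case using zeval_Fwd[OF ident_in[OF ident]] map_ident by simp
next
  case (comp f a b g c)
  have "zeval a ([Fwd f] @ [Fwd g]) = zeval b [Fwd g] \<cdot>\<^bsub>D\<^esub> zeval a [Fwd f]"
    using zeval_append[OF zigzag_Fwd[OF comp(1)] zigzag_Fwd[OF comp(2)]] .
  then show ?case
    using zeval_Fwd[OF comp(1)] zeval_Fwd[OF comp(2)] zeval_Fwd[OF comp_in[OF comp]]
      map_comp[OF comp] by (simp del: zeval.simps)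
next
  case (inv_right s)
  have h: "s \<in> hom C (Dom C s) (Cod C s)" using inv_right by (simp add: hom_def)
  show ?case
    using zeval_append[OF zigzag_Fwd[OF h] zigzag_Bwd[OF inv_right h]] zeval_Fwd[OF h]
      zeval_Bwd[OF inv_right] inverse_mor(2)[OF inverts[OF inv_right] mor_in[OF h]]
    by simp
next
  case (inv_left s)
  have h: "s \<in> hom C (Dom C s) (Cod C s)" using inv_left by (simp add: hom_def)
  show ?case
    using zeval_append[OF zigzag_Bwd[OF inv_left h] zigzag_Fwd[OF h]] zeval_Fwd[OF h]
      zeval_Bwd[OF inv_left] inverse_mor(3)[OF inverts[OF inv_left] mor_in[OF h]]
    by simp
qed auto

definition factor :: "('o, 'o \<times> 'm step list set \<times> 'o, 'p, 'n) ftor" where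
  "factor = \<lparr>ob_map = ob_map F, mor_map = (\<lambda>(a, P, b). zeval a (SOME p. p \<in> P))\<rparr>"

lemma factor_cls: "zigzag C S a p b \<Longrightarrow> mor_map factor (cls a p b) = zeval a p"
proof -
  assume "zigzag C S a p b"
  then have "zigzag_eq C S a b p (SOME q. zigzag_eq C S a b p q)"
    by (metis zigzag_eq.refl someI)
  then show ?thesis using zeval_cong by (simp add: factor_def zigzag_class_def)
qed

theorem functor_factor: "cat_functor Q D factor"
proof (intro cat_functor.intro cat_functor_axioms.intro category_fractions target.category_axioms)
  fix a assume "a \<in> Obj Q"
  then show "ob_map factor a \<in> Obj D"
    using ob_in by (simp add: factor_def)
next
  fix f a b assume "f \<in> hom Q a b"
  then show "mor_map factor f \<in> hom D (ob_map factor a) (ob_map factor b)"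
    using zeval_in by (auto simp: hom_Q factor_cls) (simp add: factor_def)
next
  fix a assume "a \<in> Obj Q"
  then show "mor_map factor (Ident Q a) = Ident D (ob_map factor a)"
    by (simp add: Ident_Q factor_cls) (simp add: factor_def)
next
  fix f g a b c assume "f \<in> hom Q a b" "g \<in> hom Q b c"
  then show "mor_map factor (g \<cdot>\<^bsub>Q\<^esub> f) = mor_map factor g \<cdot>\<^bsub>D\<^esub> mor_map factor f"
    by (auto simp: hom_Q factor_cls comp_cls zigzag_append zeval_append)
qed

theorem factor_commutes: "ftor_eq C (factor \<circ>\<^sub>F L) F"
  unfolding ftor_eq_def
proof (intro conjI ballI)
  fix f assume "f \<in> Mor C"
  then have h: "f \<in> hom C (Dom C f) (Cod C f)" by (simp add: hom_def)
  then show "mor_map (factor \<circ>\<^sub>F L) f = mor_map F f"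
    using factor_cls[OF zigzag_Fwd[OF h]] zeval_Fwd[OF h] L_mor[OF h]
    by (simp add: comp_ftor_def)
qed (simp add: comp_ftor_def factor_def)

theorem factor_unique:
  assumes H: "cat_functor Q D H" and comm: "ftor_eq C (H \<circ>\<^sub>F L) F"
  shows "ftor_eq Q H factor"
proof -
  interpret H: cat_functor Q D H by (rule H)
  have ob: "ob_map H a = ob_map F a" if "a \<in> Obj C" for a
    using comm that by (simp add: ftor_eq_def comp_ftor_def)
  have mor: "mor_map H (mor_map L f) = mor_map F f" if "f \<in> Mor C" for f
    using comm that by (simp add: ftor_eq_def comp_ftor_def)
  have ev: "mor_map H (cls a p b) = zeval a p" if "zigzag C S a p b" for a p b
    using that
  proof (induction p arbitrary: a)
    case Nil
    then show ?case using H.map_ident[of a] ob by (auto simp: Ident_Q)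
  next
    case (Cons x p)
    show ?case
    proof (cases x)
      case (Fwd f)
      then have f: "f \<in> Mor C" "Dom C f = a" "zigzag C S (Cod C f) p b"
        using Cons.prems by auto
      then have h: "f \<in> hom C a (Cod C f)" by (simp add: hom_def)
      have "mor_map H (cls a ([Fwd f] @ p) b)
              = mor_map H (cls (Cod C f) p b) \<cdot>\<^bsub>D\<^esub> mor_map H (cls a [Fwd f] (Cod C f))"
        unfolding comp_cls[OF zigzag_Fwd[OF h] f(3), symmetric]
        by (rule H.map_comp[OF cls_hom[OF zigzag_Fwd[OF h]] cls_hom[OF f(3)]])
      then show ?thesis
        using Cons.IH[OF f(3)] mor[OF f(1)] L_mor[OF h] Fwd by simp
    next
      case (Bwd s)
      then have s: "s \<in> S" "Cod C s = a" "zigzag C S (Dom C s) p b"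
        using Cons.prems by auto
      then have h: "s \<in> hom C (Dom C s) a" by (simp add: hom_def S_mor)
      let ?i = "cls a [Bwd s] (Dom C s)"
      have i: "?i \<in> hom Q a (Dom C s)" by (rule cls_hom[OF zigzag_Bwd[OF s(1) h]])
      have l: "mor_map L s \<in> hom Q (Dom C s) a"
        using cls_hom[OF zigzag_Fwd[OF h]] by (simp only: L_mor[OF h])
      have "mor_map H (cls a ([Bwd s] @ p) b) = mor_map H (cls (Dom C s) p b) \<cdot>\<^bsub>D\<^esub> mor_map H ?i"
        unfolding comp_cls[OF zigzag_Bwd[OF s(1) h] s(3), symmetric]
        by (rule H.map_comp[OF i cls_hom[OF s(3)]])
      moreover have "mor_map H ?i = inverse_mor D (mor_map F s)"
      proof (rule target.inverse_unique)
        have o: "a \<in> Obj C" "Dom C s \<in> Obj C" using h by (auto simp: hom_def)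
        show "mor_map F s \<in> hom D (ob_map F (Dom C s)) (ob_map F a)" by (rule mor_in[OF h])
        show "mor_map H ?i \<in> hom D (ob_map F a) (ob_map F (Dom C s))"
          using H.mor_in[OF i] o by (simp add: ob)
        show "inverse_mor D (mor_map F s) \<in> hom D (ob_map F a) (ob_map F (Dom C s))"
          by (rule inverse_mor(1)[OF inverts[OF s(1)] mor_in[OF h]])
        show "mor_map F s \<cdot>\<^bsub>D\<^esub> inverse_mor D (mor_map F s) = Ident D (ob_map F a)"
          by (rule inverse_mor(3)[OF inverts[OF s(1)] mor_in[OF h]])
        show "mor_map H ?i \<cdot>\<^bsub>D\<^esub> mor_map F s = Ident D (ob_map F (Dom C s))"
          using H.map_comp[OF l i] inverse_cls(1)[OF s(1) h] mor[of s] S_mor[OF s(1)] o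
            H.map_ident[of "Dom C s"] by (simp add: ob)
      qed
      ultimately show ?thesis using Cons.IH[OF s(3)] Bwd by simp
    qed
  qed
  show ?thesis
    unfolding ftor_eq_def
  proof (intro conjI ballI)
    fix a assume "a \<in> Obj Q"
    then show "ob_map H a = ob_map factor a" using ob by (simp add: factor_def)
  next
    fix f assume "f \<in> Mor Q"
    then show "mor_map H f = mor_map factor f" using ev factor_cls by (auto simp: Mor_Q)
  qed
qed

end

theorem fractions_universal:
  fixes C :: "('o, 'm) cat" and D :: "('p, 'n) cat"
  assumes "cat_functor C D F" "S \<subseteq> Mor C" "\<And>s. s \<in> S \<Longrightarrow> is_iso D (mor_map F s)"
  shows "\<exists>H. cat_functor (fractions C S) D H \<and> ftor_eq C (H \<circ>\<^sub>F fractions_ftor C S) F \<and>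
           (\<forall>K. cat_functor (fractions C S) D K \<and> ftor_eq C (K \<circ>\<^sub>F fractions_ftor C S) F
              \<longrightarrow> ftor_eq (fractions C S) K H)"
proof -
  interpret cat_functor C D F by (rule assms(1))
  interpret inverting_functor C S D F
    by unfold_locales (use assms in auto)
  show ?thesis using functor_factor factor_commutes factor_unique by blast
qed

end

theory Submission
  imports Defs
begin

text \<open>The pullback stable essential monomorphisms of \<open>C\<close> are exactly the morphisms inverted by \<open>F\<close>.
  As \<open>F\<close> is faithful and left exact, it preserves and reflects monomorphisms; so a morphism that
  it inverts is an essential monomorphism, and its pullbacks are again inverted. Conversely, \<open>F\<close>
  preserves essential monomorphisms, by transposing \<open>f : F b \<rightarrow> y\<close> to \<open>b \<rightarrow> G y\<close>, and it preserves their
  stability because every morphism into \<open>F b\<close> is, up to isomorphism, the image of a morphism into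
  \<open>b\<close>; by hypothesis the images are then isomorphisms. Hence \<open>F\<close> factors through the category of
  fractions, and \<open>G\<close> followed by the canonical functor is a quasi-inverse of the factor: the
  counit is invertible since \<open>G\<close> is fully faithful, and the unit is inverted by \<open>F\<close>, hence
  invertible in \<open>Spec C\<close>.\<close>

section \<open>Isomorphisms and monomorphisms\<close>

context category
begin

lemma homD:
  assumes "f \<in> hom C a b"
  shows "f \<in> Mor C" "Dom C f = a" "Cod C f = b" "a \<in> Obj C" "b \<in> Obj C"
  using assms by (auto simp: hom_def)

lemma is_isoI:
  assumes "f \<in> hom C a b" "g \<in> hom C b a" "g \<cdot> f = Ident C a" "f \<cdot> g = Ident C b"
  shows "is_iso C f"
  using assms by (auto simp: is_iso_def hom_def)

lemma is_isoE:
  assumes "is_iso C f" "f \<in> hom C a b"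
  obtains g where "g \<in> hom C b a" "g \<cdot> f = Ident C a" "f \<cdot> g = Ident C b"
  using inverse_mor[OF assms] by blast

lemma inverse_is_iso:
  assumes "is_iso C f" "f \<in> hom C a b" "g \<in> hom C b a" "g \<cdot> f = Ident C a"
  shows "is_iso C g"
proof -
  obtain h where h: "h \<in> hom C b a" "f \<cdot> h = Ident C b"
    using is_isoE[OF assms(1,2)] by blast
  have "g = h" by (rule inverse_unique[OF assms(2,3) h(1) assms(4) h(2)])
  then show ?thesis using is_isoI[OF assms(3,2)] assms(4) h by simp
qed

text \<open>A one-sided inverse of an isomorphism is its two-sided inverse. This side is the one met
  in the triangle identity, where \<open>mor_map F (\<eta> a)\<close> is a right inverse of a counit
  component.\<close>

lemma inverse_is_iso':
  assumes "is_iso C f" "f \<in> hom C a b" "g \<in> hom C b a" "f \<cdot> g = Ident C b"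
  shows "is_iso C g"
proof -
  obtain h where h: "h \<in> hom C b a" "h \<cdot> f = Ident C a"
    using is_isoE[OF assms(1,2)] by blast
  have "h = g" by (rule inverse_unique[OF assms(2) h(1) assms(3) h(2) assms(4)])
  then show ?thesis using inverse_is_iso[OF assms(1,2) h] by simp
qed

lemma is_iso_comp:
  assumes "is_iso C f" "f \<in> hom C a b" "is_iso C g" "g \<in> hom C b c"
  shows "is_iso C (g \<cdot> f)"
proof -
  obtain f' where f': "f' \<in> hom C b a" "f' \<cdot> f = Ident C a" "f \<cdot> f' = Ident C b"
    using is_isoE[OF assms(1,2)] by blast
  obtain g' where g': "g' \<in> hom C c b" "g' \<cdot> g = Ident C b" "g \<cdot> g' = Ident C c"
    using is_isoE[OF assms(3,4)] by blast
  show ?thesis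
  proof (rule is_isoI)
    show "g \<cdot> f \<in> hom C a c" by (rule comp_in[OF assms(2,4)])
    show "f' \<cdot> g' \<in> hom C c a" by (rule comp_in[OF g'(1) f'(1)])
    show "f' \<cdot> g' \<cdot> (g \<cdot> f) = Ident C a"
      using comp_assoc[OF comp_in[OF assms(2,4)] g'(1) f'(1)] comp_assoc[OF assms(2,4) g'(1)]
        ident_left[OF assms(2)] f'(2) g'(2) by simp
    show "g \<cdot> f \<cdot> (f' \<cdot> g') = Ident C c"
      using comp_assoc[OF comp_in[OF g'(1) f'(1)] assms(2,4)] comp_assoc[OF g'(1) f'(1) assms(2)]
        ident_left[OF g'(1)] f'(3) g'(3) by simp
  qed
qed

section \<open>Monomorphisms and their behaviour under composition\<close>

lemma is_monoI:
  assumes "m \<in> hom C a b"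
    and "\<And>x f g. f \<in> hom C x a \<Longrightarrow> g \<in> hom C x a \<Longrightarrow> m \<cdot> f = m \<cdot> g \<Longrightarrow> f = g"
  shows "is_mono C m"
  using assms by (auto simp: is_mono_def hom_def)

lemma is_monoD:
  assumes "is_mono C m" "m \<in> hom C a b" "f \<in> hom C x a" "g \<in> hom C x a" "m \<cdot> f = m \<cdot> g"
  shows "f = g"
  using assms homD(2)[OF assms(2)] homD(4)[OF assms(3)] by (simp add: is_mono_def)

lemma is_mono_comp:
  assumes "is_mono C f" "f \<in> hom C a b" "is_mono C g" "g \<in> hom C b c"
  shows "is_mono C (g \<cdot> f)"
proof (rule is_monoI[OF comp_in[OF assms(2,4)]])
  fix x h k assume hk: "h \<in> hom C x a" "k \<in> hom C x a" "g \<cdot> f \<cdot> h = g \<cdot> f \<cdot> k"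
  then have "g \<cdot> (f \<cdot> h) = g \<cdot> (f \<cdot> k)" by (simp add: comp_assoc[OF _ assms(2,4)])
  then have "f \<cdot> h = f \<cdot> k"
    using is_monoD[OF assms(3,4) comp_in[OF hk(1) assms(2)] comp_in[OF hk(2) assms(2)]] by simp
  then show "h = k" by (rule is_monoD[OF assms(1,2) hk(1,2)])
qed

lemma is_mono_cancel:
  assumes "f \<in> hom C a b" "g \<in> hom C b c" "is_mono C (g \<cdot> f)"
  shows "is_mono C f"
proof (rule is_monoI[OF assms(1)])
  fix x h k assume hk: "h \<in> hom C x a" "k \<in> hom C x a" "f \<cdot> h = f \<cdot> k"
  then have "g \<cdot> f \<cdot> h = g \<cdot> f \<cdot> k" by (simp add: comp_assoc[OF _ assms(1,2)])
  then show "h = k" by (rule is_monoD[OF assms(3) comp_in[OF assms(1,2)] hk(1,2)])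
qed

lemma is_mono_iso:
  assumes "is_iso C f" "f \<in> hom C a b"
  shows "is_mono C f"
proof (rule is_monoI[OF assms(2)])
  obtain g where g: "g \<in> hom C b a" "g \<cdot> f = Ident C a"
    using is_isoE[OF assms] by blast
  fix x h k assume hk: "h \<in> hom C x a" "k \<in> hom C x a" "f \<cdot> h = f \<cdot> k"
  then have "g \<cdot> f \<cdot> h = g \<cdot> f \<cdot> k" by (simp add: comp_assoc[OF _ assms(2) g(1)])
  then show "h = k" using g(2) hk(1,2) ident_left by simp
qed

text \<open>Composing on the right with the inverse of \<open>e\<close>, which is again a
  monomorphism, undoes the composition with \<open>e\<close>.\<close>

lemma is_mono_comp_iso_iff:
  assumes "is_iso C e" "e \<in> hom C a b" "f \<in> hom C b c"
  shows "is_mono C (f \<cdot> e) \<longleftrightarrow> is_mono C f"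
proof
  obtain e' where e': "e' \<in> hom C b a" "e' \<cdot> e = Ident C a" "e \<cdot> e' = Ident C b"
    using is_isoE[OF assms(1,2)] by blast
  assume "is_mono C (f \<cdot> e)"
  moreover have "is_mono C e'" using is_mono_iso[OF inverse_is_iso[OF assms(1,2) e'(1,2)] e'(1)] .
  ultimately have "is_mono C (f \<cdot> e \<cdot> e')"
    using is_mono_comp e'(1) comp_in[OF assms(2,3)] by blast
  then show "is_mono C f" using comp_assoc[OF e'(1) assms(2,3)] e'(3) ident_right assms(3) by simp
next
  assume "is_mono C f"
  then show "is_mono C (f \<cdot> e)" using is_mono_comp is_mono_iso assms by blast
qed

section \<open>Essential monomorphisms, up to isomorphism of source and target\<close>

lemma essential_monoI:
  assumes "m \<in> hom C a b" "is_mono C m"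
    and "\<And>c f. f \<in> hom C b c \<Longrightarrow> is_mono C (f \<cdot> m) \<Longrightarrow> is_mono C f"
  shows "essential_mono C m"
  using assms by (auto simp: essential_mono_def hom_def)

lemma essential_monoD:
  assumes "essential_mono C m" "m \<in> hom C a b" "f \<in> hom C b c" "is_mono C (f \<cdot> m)"
  shows "is_mono C f"
  using assms by (auto simp: essential_mono_def hom_def)

text \<open>A test map \<open>f\<close> for \<open>e \<cdot> m\<close> gives the test map
  \<open>f \<cdot> e\<close> for \<open>m\<close>, and \<open>e\<close> can then be cancelled from
  the resulting monomorphism.\<close>

lemma essential_mono_comp_iso:
  assumes "essential_mono C m" "m \<in> hom C a b" "is_iso C e" "e \<in> hom C b c"
  shows "essential_mono C (e \<cdot> m)"
proof (rule essential_monoI)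
  show "e \<cdot> m \<in> hom C a c" by (rule comp_in[OF assms(2,4)])
  show "is_mono C (e \<cdot> m)"
    using assms is_mono_comp is_mono_iso by (auto simp: essential_mono_def)
  fix d f assume f: "f \<in> hom C c d" "is_mono C (f \<cdot> (e \<cdot> m))"
  then have "is_mono C (f \<cdot> e)"
    using essential_monoD[OF assms(1,2) comp_in[OF assms(4) f(1)]] comp_assoc[OF assms(2,4) f(1)]
    by simp
  then show "is_mono C f" using is_mono_comp_iso_iff assms(3,4) f(1) by blast
qed

text \<open>Reparametrizing the source by \<open>k\<close> does not change which composites are
  monomorphisms. This carries essentiality from one choice of pullback projection to any
  other.\<close>

lemma essential_mono_cancel_iso:
  assumes "m \<in> hom C a b" "is_iso C k" "k \<in> hom C d a" "essential_mono C (m \<cdot> k)"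
  shows "essential_mono C m"
proof (rule essential_monoI[OF assms(1)])
  show "is_mono C m"
    using assms is_mono_comp_iso_iff by (auto simp: essential_mono_def)
  fix c f assume f: "f \<in> hom C b c" "is_mono C (f \<cdot> m)"
  then have "is_mono C (f \<cdot> m \<cdot> k)"
    using is_mono_comp_iso_iff[OF assms(2,3) comp_in[OF assms(1) f(1)]] by simp
  then show "is_mono C f"
    using essential_monoD[OF assms(4) comp_in[OF assms(3,1)] f(1)] comp_assoc[OF assms(3,1) f(1)]
    by simp
qed

section \<open>Pullbacks as finite limits\<close>

lemma pullbackI:
  assumes "f \<in> hom C a c" "g \<in> hom C b c" "p \<in> hom C d a" "q \<in> hom C d b" "f \<cdot> p = g \<cdot> q"
    and "\<And>x p' q'. p' \<in> hom C x a \<Longrightarrow> q' \<in> hom C x b \<Longrightarrow> f \<cdot> p' = g \<cdot> q'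
      \<Longrightarrow> \<exists>!h. h \<in> hom C x d \<and> p \<cdot> h = p' \<and> q \<cdot> h = q'"
  shows "pullback C f g p q"
  unfolding pullback_def
  using assms(5,6) by (auto simp: homD[OF assms(1)] homD[OF assms(2)] homD[OF assms(3)]
    homD[OF assms(4)])

lemma pullback_homs:
  assumes "pullback C f g p q"
  shows "f \<in> hom C (Dom C f) (Cod C g) \<and> g \<in> hom C (Dom C g) (Cod C g) \<and>
    p \<in> hom C (Dom C q) (Dom C f) \<and> q \<in> hom C (Dom C q) (Dom C g) \<and> f \<cdot> p = g \<cdot> q"
  using assms unfolding pullback_def hom_def by simp

lemma pullbackE:
  assumes "pullback C f g p q"
  obtains a b c d where "f \<in> hom C a c" "g \<in> hom C b c" "p \<in> hom C d a" "q \<in> hom C d b"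
    "f \<cdot> p = g \<cdot> q"
  using pullback_homs[OF assms] by blast

lemma pullback_universal:
  assumes "pullback C f g p q" "p \<in> hom C d a" "q \<in> hom C d b"
    "p' \<in> hom C x a" "q' \<in> hom C x b" "f \<cdot> p' = g \<cdot> q'"
  shows "\<exists>!h. h \<in> hom C x d \<and> p \<cdot> h = p' \<and> q \<cdot> h = q'"
proof -
  have "x \<in> Obj C" "Dom C p = d" "Dom C f = a" "Dom C g = b"
    using pullback_homs[OF assms(1)] homD[OF assms(2)] homD[OF assms(3)] homD[OF assms(4)]
    by (auto simp: hom_def)
  then show ?thesis using assms unfolding pullback_def by blast
qed

text \<open>The two projections of a pullback are jointly monic: both maps solve the same
  factorization problem.\<close>

lemma pullback_eqI:
  assumes pb: "pullback C f g p q" and p: "p \<in> hom C d a" and q: "q \<in> hom C d b"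
    and h: "h \<in> hom C x d" and k: "k \<in> hom C x d" and eq: "p \<cdot> h = p \<cdot> k" "q \<cdot> h = q \<cdot> k"
  shows "h = k"
proof -
  obtain c where f: "f \<in> hom C a c" and g: "g \<in> hom C b c" and "f \<cdot> p = g \<cdot> q"
    using pb p q by (auto simp: hom_def dest!: pullback_homs)
  then have "f \<cdot> (p \<cdot> k) = g \<cdot> (q \<cdot> k)"
    using comp_assoc[OF k p f] comp_assoc[OF k q g] by simp
  from pullback_universal[OF pb p q comp_in[OF k p] comp_in[OF k q] this]
  show ?thesis using h k eq by blast
qed

text \<open>The universal properties give maps in both directions, and joint monicity of the
  projections makes them mutually inverse. Stability speaks of every pullback, whereas a
  construction yields only one; \<open>k\<close> bridges the two.\<close>

lemma pullback_comparison:
  assumes "pullback C f g p q" "pullback C f g p' q'"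
    and q: "q \<in> hom C d b" and q': "q' \<in> hom C d' b"
  shows "\<exists>k. k \<in> hom C d' d \<and> is_iso C k \<and> q \<cdot> k = q'"
proof -
  define a where "a = Dom C f"
  have p: "p \<in> hom C d a" "p' \<in> hom C d' a" and eq: "f \<cdot> p = g \<cdot> q" "f \<cdot> p' = g \<cdot> q'"
    using pullback_homs[OF assms(1)] pullback_homs[OF assms(2)] homD(2)[OF q] homD(2)[OF q']
    by (simp_all add: a_def)
  note u = pullback_universal[OF assms(1) p(1) q]
  note u' = pullback_universal[OF assms(2) p(2) q']
  obtain k where k: "k \<in> hom C d' d" "p \<cdot> k = p'" "q \<cdot> k = q'"
    using u[OF p(2) q' eq(2)] by blast
  obtain l where l: "l \<in> hom C d d'" "p' \<cdot> l = p" "q' \<cdot> l = q"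
    using u'[OF p(1) q eq(1)] by blast
  have "l \<cdot> k = Ident C d'"
  proof (rule pullback_eqI[OF assms(2) p(2) q' comp_in[OF k(1) l(1)]])
    show "Ident C d' \<in> hom C d' d'" using ident_in homD[OF q'] by simp
    show "p' \<cdot> (l \<cdot> k) = p' \<cdot> Ident C d'" "q' \<cdot> (l \<cdot> k) = q' \<cdot> Ident C d'"
      using comp_assoc[OF k(1) l(1) p(2)] comp_assoc[OF k(1) l(1) q'] k l
        ident_right[OF p(2)] ident_right[OF q'] by simp_all
  qed
  moreover have "k \<cdot> l = Ident C d"
  proof (rule pullback_eqI[OF assms(1) p(1) q comp_in[OF l(1) k(1)]])
    show "Ident C d \<in> hom C d d" using ident_in homD[OF q] by simp
    show "p \<cdot> (k \<cdot> l) = p \<cdot> Ident C d" "q \<cdot> (k \<cdot> l) = q \<cdot> Ident C d"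
      using comp_assoc[OF l(1) k(1) p(1)] comp_assoc[OF l(1) k(1) q] k l
        ident_right[OF p(1)] ident_right[OF q] by simp_all
  qed
  ultimately show ?thesis using is_isoI[OF k(1) l(1)] k by blast
qed

text \<open>Maps \<open>q'\<close> into \<open>b\<close> correspond to maps
  \<open>e' \<cdot> q'\<close> into \<open>b'\<close>, where \<open>e'\<close> is the inverse of
  \<open>e\<close>, so the two universal properties translate into each other.\<close>

lemma pullback_along_iso:
  assumes pb: "pullback C m (u \<cdot> e) p q" and u: "u \<in> hom C b c" and e: "e \<in> hom C b' b"
    and iso: "is_iso C e"
  shows "pullback C m u p (e \<cdot> q)"
proof -
  obtain a d where h: "m \<in> hom C a c" "p \<in> hom C d a" "q \<in> hom C d b'"
    and eq: "m \<cdot> p = u \<cdot> e \<cdot> q"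
    using pb comp_in[OF e u] by (auto simp: hom_def dest!: pullback_homs)
  obtain e' where e': "e' \<in> hom C b b'" "e' \<cdot> e = Ident C b'" "e \<cdot> e' = Ident C b"
    using is_isoE[OF iso e] by blast
  show ?thesis
  proof (rule pullbackI[OF h(1) u h(2) comp_in[OF h(3) e]])
    show "m \<cdot> p = u \<cdot> (e \<cdot> q)" using eq comp_assoc[OF h(3) e u] by simp
    fix x p' q' assume a: "p' \<in> hom C x a" "q' \<in> hom C x b" "m \<cdot> p' = u \<cdot> q'"
    have e'q': "e' \<cdot> q' \<in> hom C x b'" by (rule comp_in[OF a(2) e'(1)])
    have ee': "e \<cdot> (e' \<cdot> q') = q'"
      using comp_assoc[OF a(2) e'(1) e] e'(3) ident_left[OF a(2)] by simp
    have "m \<cdot> p' = u \<cdot> e \<cdot> (e' \<cdot> q')"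
      using a(3) ee' comp_assoc[OF e'q' e u] by simp
    then have un: "\<exists>!h. h \<in> hom C x d \<and> p \<cdot> h = p' \<and> q \<cdot> h = e' \<cdot> q'"
      by (rule pullback_universal[OF pb h(2,3) a(1) e'q'])
    \<comment> \<open>With this equivalence the two factorization problems have the same solutions,
      and unique existence carries over as a whole.\<close>
    have "q \<cdot> k = e' \<cdot> q' \<longleftrightarrow> e \<cdot> q \<cdot> k = q'" if k: "k \<in> hom C x d" for k
    proof
      assume "q \<cdot> k = e' \<cdot> q'"
      then show "e \<cdot> q \<cdot> k = q'" using comp_assoc[OF k h(3) e] ee' by simp
    next
      assume "e \<cdot> q \<cdot> k = q'"
      then have "e' \<cdot> q' = e' \<cdot> (e \<cdot> (q \<cdot> k))" using comp_assoc[OF k h(3) e] by simp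
      then show "q \<cdot> k = e' \<cdot> q'"
        using comp_assoc[OF comp_in[OF k h(3)] e e'(1)] e'(2) ident_left[OF comp_in[OF k h(3)]]
        by simp
    qed
    then have "k \<in> hom C x d \<and> p \<cdot> k = p' \<and> e \<cdot> q \<cdot> k = q' \<longleftrightarrow>
        k \<in> hom C x d \<and> p \<cdot> k = p' \<and> q \<cdot> k = e' \<cdot> q'" for k by blast
    then show "\<exists>!k. k \<in> hom C x d \<and> p \<cdot> k = p' \<and> e \<cdot> q \<cdot> k = q'" using un by simp
  qed
qed

text \<open>The pair \<open>f' \<cdot> g\<close> and identity, with \<open>f'\<close> the inverse of
  \<open>f\<close>, induces a section \<open>k\<close> of \<open>q\<close>; joint monicity shows
  that \<open>k\<close> is also a left inverse.\<close>

lemma pullback_of_iso: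
  assumes pb: "pullback C f g p q" and iso: "is_iso C f"
  shows "is_iso C q"
proof -
  obtain a b c d where h: "f \<in> hom C a c" "g \<in> hom C b c" "p \<in> hom C d a" "q \<in> hom C d b"
    and eq: "f \<cdot> p = g \<cdot> q"
    by (rule pullbackE[OF pb])
  obtain f' where f': "f' \<in> hom C c a" "f' \<cdot> f = Ident C a" "f \<cdot> f' = Ident C c"
    using is_isoE[OF iso h(1)] by blast
  have o: "b \<in> Obj C" "d \<in> Obj C" using homD[OF h(4)] by auto
  have fg: "f' \<cdot> g \<in> hom C b a" by (rule comp_in[OF h(2) f'(1)])
  have "f \<cdot> (f' \<cdot> g) = g \<cdot> Ident C b"
    using comp_assoc[OF h(2) f'(1) h(1)] f'(3) ident_left[OF h(2)] ident_right[OF h(2)] by simp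
  from pullback_universal[OF pb h(3,4) fg ident_in[OF o(1)] this]
  obtain k where k: "k \<in> hom C b d" "p \<cdot> k = f' \<cdot> g" "q \<cdot> k = Ident C b" by blast
  have kq: "k \<cdot> q \<in> hom C d d" by (rule comp_in[OF h(4) k(1)])
  have "p = f' \<cdot> (g \<cdot> q)"
    using eq comp_assoc[OF h(3,1) f'(1)] f'(2) ident_left[OF h(3)] by simp
  then have "p \<cdot> (k \<cdot> q) = p"
    using comp_assoc[OF h(4) k(1) h(3)] comp_assoc[OF h(4,2) f'(1)] k by simp
  moreover have "q \<cdot> (k \<cdot> q) = q" using comp_assoc[OF h(4) k(1) h(4)] k ident_left[OF h(4)] by simp
  ultimately have "k \<cdot> q = Ident C d"
    using pullback_eqI[OF pb h(3,4) kq ident_in[OF o(2)]] ident_right[OF h(3)] ident_right[OF h(4)]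
    by simp
  then show ?thesis using is_isoI[OF h(4) k(1)] k by blast
qed

text \<open>A monomorphism is a morphism with trivial kernel pair. In this form the property is
  visibly preserved by functors that preserve pullbacks.\<close>

lemma is_mono_iff_pullback:
  assumes m: "m \<in> hom C a b"
  shows "is_mono C m \<longleftrightarrow> pullback C m m (Ident C a) (Ident C a)"
proof
  have i: "Ident C a \<in> hom C a a" using ident_in homD[OF m] by blast
  assume mono: "is_mono C m"
  show "pullback C m m (Ident C a) (Ident C a)"
  proof (rule pullbackI[OF m m i i])
    fix x p q assume a: "p \<in> hom C x a" "q \<in> hom C x a" "m \<cdot> p = m \<cdot> q"
    then have "p = q" by (rule is_monoD[OF mono m])
    then show "\<exists>!h. h \<in> hom C x a \<and> Ident C a \<cdot> h = p \<and> Ident C a \<cdot> h = q"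
      using a ident_left by auto
  qed simp
next
  have i: "Ident C a \<in> hom C a a" using ident_in homD[OF m] by blast
  assume pb: "pullback C m m (Ident C a) (Ident C a)"
  show "is_mono C m"
  proof (rule is_monoI[OF m])
    fix x f g assume a: "f \<in> hom C x a" "g \<in> hom C x a" "m \<cdot> f = m \<cdot> g"
    show "f = g"
      using pullback_universal[OF pb i i a] ident_left[of _ x a] by auto
  qed
qed

end

text \<open>The walking cospan: the numbers 0, 1, 2 are the objects and their identities,
  3 is the arrow from 0 to 2, and 4 is the arrow from 1 to 2.\<close>

definition cospan_cat :: "(nat, nat) cat" where
  "cospan_cat = \<lparr>Obj = {0, 1, 2}, Mor = {0, 1, 2, 3, 4},
     Dom = (\<lambda>u. if u = 3 then 0 else if u = 4 then 1 else u),
     Cod = (\<lambda>u. if u = 3 \<or> u = 4 then 2 else u),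
     Ident = (\<lambda>a. a), Comp = (\<lambda>g f. if g = 3 \<or> g = 4 then g else f)\<rparr>"

definition cospan_ftor :: "('o, 'm) cat \<Rightarrow> 'm \<Rightarrow> 'm \<Rightarrow> (nat, nat, 'o, 'm) ftor" where
  "cospan_ftor C f g =
     (let ob = (\<lambda>j. if j = 0 then Dom C f else if j = 1 then Dom C g else Cod C f) in
      \<lparr>ob_map = ob, mor_map = (\<lambda>u. if u = 3 then f else if u = 4 then g else Ident C (ob u))\<rparr>)"

lemma category_cospan: "category cospan_cat"
  by unfold_locales (auto simp: cospan_cat_def hom_def split: if_splits)

lemma finite_category_cospan: "finite_category cospan_cat"
  using category_cospan by (simp add: finite_category_def) (simp add: cospan_cat_def)

lemma hom_cospan:
  "u \<in> hom cospan_cat x y \<longleftrightarrow>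
    u = x \<and> x = y \<and> x \<in> {0, 1, 2} \<or> u = 3 \<and> x = 0 \<and> y = 2 \<or> u = 4 \<and> x = 1 \<and> y = 2"
  by (auto simp: cospan_cat_def hom_def)

lemma Obj_cospan: "Obj cospan_cat = {0, 1, 2}" and Ident_cospan: "Ident cospan_cat x = x"
  by (simp_all add: cospan_cat_def)

lemma (in category) functor_cospan:
  assumes f: "f \<in> hom C a c" and g: "g \<in> hom C b c"
  shows "cat_functor cospan_cat C (cospan_ftor C f g)" (is "cat_functor _ _ ?D")
proof (intro cat_functor.intro cat_functor_axioms.intro category_cospan category_axioms)
  have ob: "ob_map ?D 0 = a" "ob_map ?D 1 = b" "ob_map ?D 2 = c"
    and mor: "mor_map ?D 0 = Ident C a" "mor_map ?D 1 = Ident C b" "mor_map ?D 2 = Ident C c"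
      "mor_map ?D 3 = f" "mor_map ?D 4 = g"
    using homD[OF f] homD[OF g] by (simp_all add: cospan_ftor_def Let_def)
  have i: "Ident C a \<in> hom C a a" "Ident C b \<in> hom C b b" "Ident C c \<in> hom C c c"
    using ident_in homD[OF f] homD[OF g] by auto
  note ids = ident_left[OF f] ident_left[OF g] ident_right[OF f] ident_right[OF g]
    i[THEN ident_left]
  {
    fix x assume "x \<in> Obj cospan_cat"
    then have x: "x = 0 \<or> x = 1 \<or> x = 2" by (simp add: Obj_cospan)
    show "ob_map ?D x \<in> Obj C"
      using x ob homD[OF f] homD[OF g] by auto
    show "mor_map ?D (Ident cospan_cat x) = Ident C (ob_map ?D x)"
      unfolding Ident_cospan using x ob mor by auto
  next
    fix u x y assume "u \<in> hom cospan_cat x y"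
    then show "mor_map ?D u \<in> hom C (ob_map ?D x) (ob_map ?D y)"
      unfolding hom_cospan using ob mor i f g by auto
  next
    fix u v x y z assume "u \<in> hom cospan_cat x y" "v \<in> hom cospan_cat y z"
    \<comment> \<open>In a composable pair at least one factor is an identity: if \<open>v\<close>
      is 3 or 4 then \<open>u\<close> is, and otherwise \<open>v\<close> is.\<close>
    moreover have "v \<cdot>\<^bsub>cospan_cat\<^esub> u = (if v = 3 \<or> v = 4 then v else u)"
      by (simp add: cospan_cat_def)
    ultimately show "mor_map ?D (v \<cdot>\<^bsub>cospan_cat\<^esub> u) = mor_map ?D v \<cdot> mor_map ?D u"
      unfolding hom_cospan using mor ids by auto
  }
qed

text \<open>Such a cone is a commutative square: the leg at 2 is the common composite, and
  identities impose no condition. \<open>D\<close> is arbitrary so that the result also covers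
  \<open>F \<circ>\<^sub>F cospan_ftor C f g\<close>, which agrees with a \<open>cospan_ftor\<close>
  only on the carrier.\<close>

lemma cospan_cone_iff:
  assumes "cat_functor cospan_cat C D"
  shows "cone cospan_cat C D l \<pi> \<longleftrightarrow>
    \<pi> 0 \<in> hom C l (ob_map D 0) \<and> \<pi> 1 \<in> hom C l (ob_map D 1) \<and>
    mor_map D 3 \<cdot>\<^bsub>C\<^esub> \<pi> 0 = \<pi> 2 \<and> mor_map D 4 \<cdot>\<^bsub>C\<^esub> \<pi> 1 = \<pi> 2" (is "_ \<longleftrightarrow> ?R")
proof -
  interpret cat_functor cospan_cat C D by (rule assms)
  have id: "mor_map D j = Ident C (ob_map D j)" if "j \<in> {0, 1, 2}" for j
    using map_ident[of j] that by (simp add: Obj_cospan Ident_cospan)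
  have d: "mor_map D 3 \<in> hom C (ob_map D 0) (ob_map D 2)"
    by (rule mor_in) (simp add: cospan_cat_def hom_def)
  show ?thesis
  proof
    assume "cone cospan_cat C D l \<pi>"
    then show ?R by (auto simp: cone_def cospan_cat_def)
  next
    assume R: ?R
    then have \<pi>: "\<pi> 0 \<in> hom C l (ob_map D 0)" "\<pi> 1 \<in> hom C l (ob_map D 1)"
      "\<pi> 2 \<in> hom C l (ob_map D 2)"
      using target.comp_in[OF _ d, of "\<pi> 0" l] by simp_all
    show "cone cospan_cat C D l \<pi>"
      using R \<pi> id[of 0] id[of 1] id[of 2] \<pi>[THEN target.ident_left] target.homD(4)[OF \<pi>(1)]
      by (simp add: cone_def cospan_cat_def)
  qed
qed

lemma pullback_of_limit_cone:
  assumes D: "cat_functor cospan_cat C D" and lim: "limit_cone cospan_cat C D l \<pi>"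
  shows "pullback C (mor_map D 3) (mor_map D 4) (\<pi> 0) (\<pi> 1)"
proof -
  interpret cat_functor cospan_cat C D by (rule D)
  let ?f = "mor_map D 3" and ?g = "mor_map D 4"
  have f: "?f \<in> hom C (ob_map D 0) (ob_map D 2)" and g: "?g \<in> hom C (ob_map D 1) (ob_map D 2)"
    by (rule mor_in, simp add: cospan_cat_def hom_def)+
  have c: "\<pi> 0 \<in> hom C l (ob_map D 0)" "\<pi> 1 \<in> hom C l (ob_map D 1)"
    "?f \<cdot>\<^bsub>C\<^esub> \<pi> 0 = \<pi> 2" "?g \<cdot>\<^bsub>C\<^esub> \<pi> 1 = \<pi> 2"
    using lim cospan_cone_iff[OF D] by (auto simp: limit_cone_def)
  show ?thesis
  proof (rule target.pullbackI[OF f g c(1,2)])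
    show "?f \<cdot>\<^bsub>C\<^esub> \<pi> 0 = ?g \<cdot>\<^bsub>C\<^esub> \<pi> 1" using c by simp
    fix x p q
    assume a: "p \<in> hom C x (ob_map D 0)" "q \<in> hom C x (ob_map D 1)" "?f \<cdot>\<^bsub>C\<^esub> p = ?g \<cdot>\<^bsub>C\<^esub> q"
    \<comment> \<open>The leg at 2 is forced to be the common composite of the square.\<close>
    define \<kappa> where "\<kappa> j = (if j = 0 then p else if j = 1 then q else ?f \<cdot>\<^bsub>C\<^esub> p)" for j :: nat
    have "cone cospan_cat C D x \<kappa>" using a by (simp add: cospan_cone_iff[OF D] \<kappa>_def)
    then have "\<exists>!h. h \<in> hom C x l \<and> (\<forall>j\<in>Obj cospan_cat. \<pi> j \<cdot>\<^bsub>C\<^esub> h = \<kappa> j)"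
      using lim by (simp add: limit_cone_def)
    moreover have "h \<in> hom C x l \<and> (\<forall>j\<in>Obj cospan_cat. \<pi> j \<cdot>\<^bsub>C\<^esub> h = \<kappa> j) \<longleftrightarrow>
        h \<in> hom C x l \<and> \<pi> 0 \<cdot>\<^bsub>C\<^esub> h = p \<and> \<pi> 1 \<cdot>\<^bsub>C\<^esub> h = q" for h
      using target.comp_assoc[OF _ c(1) f, of h x] c(3) by (auto simp: \<kappa>_def Obj_cospan)
    ultimately show "\<exists>!h. h \<in> hom C x l \<and> \<pi> 0 \<cdot>\<^bsub>C\<^esub> h = p \<and> \<pi> 1 \<cdot>\<^bsub>C\<^esub> h = q" by simp
  qed
qed

context category
begin

lemma limit_cone_of_pullback:
  assumes pb: "pullback C f g p q"
  shows "limit_cone cospan_cat C (cospan_ftor C f g) (Dom C p)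
    (\<lambda>j. if j = 0 then p else if j = 1 then q else f \<cdot> p)" (is "limit_cone _ _ ?D _ ?\<pi>")
proof -
  obtain a b c d where h: "f \<in> hom C a c" "g \<in> hom C b c" "p \<in> hom C d a" "q \<in> hom C d b"
    and eq: "f \<cdot> p = g \<cdot> q"
    by (rule pullbackE[OF pb])
  have [simp]: "ob_map ?D 0 = a" "ob_map ?D 1 = b" "ob_map ?D (Suc 0) = b"
    "mor_map ?D 3 = f" "mor_map ?D 4 = g"
    "Dom C p = d"
    using h by (auto simp: cospan_ftor_def Let_def hom_def)
  note cone_iff = cospan_cone_iff[OF functor_cospan[OF h(1,2)]]
  show ?thesis
    unfolding limit_cone_def
  proof (intro conjI allI impI)
    show "cone cospan_cat C ?D (Dom C p) ?\<pi>"
      using h eq by (simp add: cone_iff)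
    fix k \<kappa> assume "cone cospan_cat C ?D k \<kappa>"
    then have \<kappa>: "\<kappa> 0 \<in> hom C k a" "\<kappa> 1 \<in> hom C k b" "f \<cdot> \<kappa> 0 = \<kappa> 2" "g \<cdot> \<kappa> 1 = \<kappa> 2"
      by (auto simp: cone_iff)
    have "\<exists>!u. u \<in> hom C k d \<and> p \<cdot> u = \<kappa> 0 \<and> q \<cdot> u = \<kappa> 1"
      using pullback_universal[OF pb h(3,4) \<kappa>(1,2)] \<kappa>(3,4) by simp
    moreover have "u \<in> hom C k (Dom C p) \<and> (\<forall>j\<in>Obj cospan_cat. ?\<pi> j \<cdot> u = \<kappa> j) \<longleftrightarrow>
        u \<in> hom C k d \<and> p \<cdot> u = \<kappa> 0 \<and> q \<cdot> u = \<kappa> 1" for u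
      using comp_assoc[OF _ h(3,1), of u k] \<kappa>(3) by (auto simp: Obj_cospan)
    ultimately show "\<exists>!u. u \<in> hom C k (Dom C p) \<and> (\<forall>j\<in>Obj cospan_cat. ?\<pi> j \<cdot> u = \<kappa> j)"
      by (simp only:)
  qed
qed

lemma pullback_exists:
  assumes "has_finite_limits C" and f: "f \<in> hom C a c" and g: "g \<in> hom C b c"
  shows "\<exists>p q. pullback C f g p q"
proof -
  have D: "cat_functor cospan_cat C (cospan_ftor C f g)" by (rule functor_cospan[OF f g])
  then obtain l \<pi> where "limit_cone cospan_cat C (cospan_ftor C f g) l \<pi>"
    using assms(1) finite_category_cospan unfolding has_finite_limits_def by blast
  from pullback_of_limit_cone[OF D this] show ?thesis
    by (auto simp: cospan_ftor_def Let_def)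
qed

end

section \<open>Identity and composite functors, and preservation of pullbacks\<close>

lemma functor_id: "category C \<Longrightarrow> cat_functor C C id_ftor"
  by (simp add: cat_functor_def cat_functor_axioms_def id_ftor_def)

lemma functor_comp:
  assumes "cat_functor C D F" "cat_functor D E G"
  shows "cat_functor C E (G \<circ>\<^sub>F F)"
proof -
  interpret F: cat_functor C D F by (rule assms(1))
  interpret G: cat_functor D E G by (rule assms(2))
  show ?thesis
    by unfold_locales
      (auto simp: comp_ftor_def F.map_ident G.map_ident F.ob_in G.ob_in
        F.map_comp G.map_comp[OF F.mor_in F.mor_in] intro: F.mor_in G.mor_in)
qed

text \<open>Finite limits are phrased through diagrams of numbers, so the square is read as a limit
  cone over the walking cospan, mapped by \<open>F\<close>, and read back as a square.\<close>

lemma preserves_pullback: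
  assumes F: "cat_functor C X F" and "preserves_finite_limits C X F" and pb: "pullback C f g p q"
  shows "pullback X (mor_map F f) (mor_map F g) (mor_map F p) (mor_map F q)"
proof -
  interpret cat_functor C X F by (rule F)
  have D: "cat_functor cospan_cat C (cospan_ftor C f g)"
    using source.pullback_homs[OF pb] source.functor_cospan[of f _ _ g] by blast
  have "limit_cone cospan_cat X (F \<circ>\<^sub>F cospan_ftor C f g) (ob_map F (Dom C p))
      (mor_map F \<circ> (\<lambda>j. if j = 0 then p else if j = 1 then q else f \<cdot>\<^bsub>C\<^esub> p))"
    using assms(2) finite_category_cospan D source.limit_cone_of_pullback[OF pb]
    unfolding preserves_finite_limits_def by blast
  from pullback_of_limit_cone[OF functor_comp[OF D F] this] show ?thesis
    by (simp add: comp_ftor_def cospan_ftor_def Let_def)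
qed

section \<open>Natural transformations on a category of fractions\<close>

text \<open>Naturality squares paste along composition, and the square at an isomorphism yields the
  one at its inverse. Every zigzag is composed of images of morphisms of \<open>C\<close> and
  inverses of members of \<open>S\<close>, so naturality on the image of \<open>L\<close>
  suffices.\<close>

lemma (in fractions_setup) nat_trans_fractionsI:
  assumes M: "cat_functor Q D M" and N: "cat_functor Q D N"
    and \<tau>: "\<And>a. a \<in> Obj C \<Longrightarrow> \<tau> a \<in> hom D (ob_map M a) (ob_map N a)"
    and nat: "\<And>f. f \<in> Mor C \<Longrightarrow>
      \<tau> (Cod C f) \<cdot>\<^bsub>D\<^esub> mor_map M (mor_map L f) = mor_map N (mor_map L f) \<cdot>\<^bsub>D\<^esub> \<tau> (Dom C f)"
  shows "nat_trans Q D M N \<tau>"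
proof -
  interpret M: cat_functor Q D M by (rule M)
  interpret N: cat_functor Q D N by (rule N)
  let ?nat = "\<lambda>h a b. \<tau> b \<cdot>\<^bsub>D\<^esub> mor_map M h = mor_map N h \<cdot>\<^bsub>D\<^esub> \<tau> a"
  have comp: "?nat (k \<cdot>\<^bsub>Q\<^esub> h) a c"
    if "h \<in> hom Q a b" "k \<in> hom Q b c" "?nat h a b" "?nat k b c" for h k a b c
  proof -
    have o: "a \<in> Obj C" "b \<in> Obj C" "c \<in> Obj C"
      using M.source.homD[OF that(1)] M.source.homD[OF that(2)] by auto
    note t = \<tau>[OF o(1)] \<tau>[OF o(2)] \<tau>[OF o(3)]
    note m = M.mor_in[OF that(1)] M.mor_in[OF that(2)] N.mor_in[OF that(1)] N.mor_in[OF that(2)]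
    have "\<tau> c \<cdot>\<^bsub>D\<^esub> (mor_map M k \<cdot>\<^bsub>D\<^esub> mor_map M h) = mor_map N k \<cdot>\<^bsub>D\<^esub> \<tau> b \<cdot>\<^bsub>D\<^esub> mor_map M h"
      using M.target.comp_assoc[OF m(1,2) t(3)] that(4) by simp
    also have "\<dots> = mor_map N k \<cdot>\<^bsub>D\<^esub> mor_map N h \<cdot>\<^bsub>D\<^esub> \<tau> a"
      using M.target.comp_assoc[OF m(1) t(2) m(4)] M.target.comp_assoc[OF t(1) m(3,4)] that(3)
      by simp
    finally show ?thesis using M.map_comp[OF that(1,2)] N.map_comp[OF that(1,2)] by simp
  qed
  have inv: "?nat k b a"
    if "h \<in> hom Q a b" "k \<in> hom Q b a" "k \<cdot>\<^bsub>Q\<^esub> h = Ident Q a" "h \<cdot>\<^bsub>Q\<^esub> k = Ident Q b" "?nat h a b"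
    for h k a b
  proof -
    have o: "a \<in> Obj C" "b \<in> Obj C" using M.source.homD[OF that(1)] by auto
    note t = \<tau>[OF o(1)] \<tau>[OF o(2)]
    note m = M.mor_in[OF that(1)] M.mor_in[OF that(2)] N.mor_in[OF that(1)] N.mor_in[OF that(2)]
    have NN: "mor_map N k \<cdot>\<^bsub>D\<^esub> mor_map N h = Ident D (ob_map N a)"
      using N.map_comp[OF that(1,2)] that(3) N.map_ident o by simp
    have MM: "mor_map M h \<cdot>\<^bsub>D\<^esub> mor_map M k = Ident D (ob_map M b)"
      using M.map_comp[OF that(2,1)] that(4) M.map_ident o by simp
    have tk: "\<tau> a \<cdot>\<^bsub>D\<^esub> mor_map M k \<in> hom D (ob_map M b) (ob_map N a)"
      by (rule M.target.comp_in[OF m(2) t(1)])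
    \<comment> \<open>The square at \<open>h\<close> is conjugated by \<open>k\<close>: the identity
      \<open>mor_map N k \<cdot> mor_map N h\<close> is inserted on the left, and
      \<open>mor_map M h \<cdot> mor_map M k\<close> then cancels on the right.\<close>
    have "\<tau> a \<cdot>\<^bsub>D\<^esub> mor_map M k = mor_map N k \<cdot>\<^bsub>D\<^esub> (mor_map N h \<cdot>\<^bsub>D\<^esub> (\<tau> a \<cdot>\<^bsub>D\<^esub> mor_map M k))"
      using M.target.comp_assoc[OF tk m(3,4)] NN M.target.ident_left[OF tk] by simp
    also have "mor_map N h \<cdot>\<^bsub>D\<^esub> (\<tau> a \<cdot>\<^bsub>D\<^esub> mor_map M k) = \<tau> b \<cdot>\<^bsub>D\<^esub> mor_map M h \<cdot>\<^bsub>D\<^esub> mor_map M k"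
      using M.target.comp_assoc[OF m(2) t(1) m(3)] that(5) by simp
    also have "\<dots> = \<tau> b"
      using M.target.comp_assoc[OF m(2,1) t(2)] MM M.target.ident_right[OF t(2)] by simp
    finally show ?thesis .
  qed
  have fwd: "?nat (cls a [Fwd f] b) a b" if "f \<in> hom C a b" for f a b
    using nat[of f] homD[OF that] L_mor[OF that] by simp
  have "?nat (cls a p b) a b" if "zigzag C S a p b" for a p b
    using that
  proof (induction p arbitrary: a)
    case Nil
    then have a: "a = b" "a \<in> Obj C" by auto
    then show ?case
      using M.map_ident[of a] N.map_ident[of a] M.target.ident_right[OF \<tau>[OF a(2)]]
        M.target.ident_left[OF \<tau>[OF a(2)]]
      by (simp add: Ident_Q)
  next
    case (Cons x p)
    show ?case
    proof (cases x)
      case (Fwd f)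
      then have f: "f \<in> hom C a (Cod C f)" "zigzag C S (Cod C f) p b"
        using Cons.prems by (auto simp: hom_def)
      show ?thesis
        using comp[OF cls_hom[OF zigzag_Fwd[OF f(1)]] cls_hom[OF f(2)] fwd[OF f(1)]
            Cons.IH[OF f(2)]] comp_cls[OF zigzag_Fwd[OF f(1)] f(2)] Fwd
        by simp
    next
      case (Bwd s)
      then have s: "s \<in> S" "s \<in> hom C (Dom C s) a" "zigzag C S (Dom C s) p b"
        using Cons.prems by (auto simp: hom_def)
      note z = zigzag_Bwd[OF s(1,2)]
      have "?nat (cls a [Bwd s] (Dom C s)) a (Dom C s)"
        using inv[OF cls_hom[OF zigzag_Fwd[OF s(2)]] cls_hom[OF z] _ _ fwd[OF s(2)]]
          inverse_cls[OF s(1,2)] L_mor[OF s(2)] by metis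
      then show ?thesis
        using comp[OF cls_hom[OF z] cls_hom[OF s(3)] _ Cons.IH[OF s(3)]] comp_cls[OF z s(3)] Bwd
        by simp
    qed
  qed
  then show ?thesis
    using M N \<tau> by (auto simp: nat_trans_def Mor_Q)
qed

section \<open>Faithful localizations\<close>

locale faithful_localization =
  fixes C :: "('o, 'm) cat" and X :: "('p, 'n) cat"
    and F :: "('o, 'm, 'p, 'n) ftor" and G :: "('p, 'n, 'o, 'm) ftor"
    and \<eta> :: "'o \<Rightarrow> 'm" and \<epsilon> :: "'p \<Rightarrow> 'n"
  assumes limits: "has_finite_limits C"
    and localization: "localization C X F G \<eta> \<epsilon>"
    and faithful: "faithful C X F"
begin

sublocale F: cat_functor C X F
  using localization by (simp add: localization_def adjunction_def)

sublocale G: cat_functor X C G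
  using localization by (simp add: localization_def adjunction_def)

section \<open>Unit and counit of the adjunction\<close>

lemma unit_in: "a \<in> Obj C \<Longrightarrow> \<eta> a \<in> hom C a (ob_map G (ob_map F a))"
  using localization
  by (auto simp: localization_def adjunction_def nat_trans_def id_ftor_def comp_ftor_def)

lemma counit_in: "x \<in> Obj X \<Longrightarrow> \<epsilon> x \<in> hom X (ob_map F (ob_map G x)) x"
  using localization
  by (auto simp: localization_def adjunction_def nat_trans_def id_ftor_def comp_ftor_def)

lemma unit_natural:
  assumes "f \<in> hom C a b"
  shows "\<eta> b \<cdot>\<^bsub>C\<^esub> f = mor_map G (mor_map F f) \<cdot>\<^bsub>C\<^esub> \<eta> a"
  using localization F.source.homD[OF assms]
  by (auto simp: localization_def adjunction_def nat_trans_def id_ftor_def comp_ftor_def)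

lemma counit_natural:
  assumes "f \<in> hom X x y"
  shows "\<epsilon> y \<cdot>\<^bsub>X\<^esub> mor_map F (mor_map G f) = f \<cdot>\<^bsub>X\<^esub> \<epsilon> x"
  using localization F.target.homD[OF assms]
  by (auto simp: localization_def adjunction_def nat_trans_def id_ftor_def comp_ftor_def)

lemma triangle_F: "a \<in> Obj C \<Longrightarrow> \<epsilon> (ob_map F a) \<cdot>\<^bsub>X\<^esub> mor_map F (\<eta> a) = Ident X (ob_map F a)"
  and triangle_G: "x \<in> Obj X \<Longrightarrow> mor_map G (\<epsilon> x) \<cdot>\<^bsub>C\<^esub> \<eta> (ob_map G x) = Ident C (ob_map G x)"
  using localization by (auto simp: localization_def adjunction_def)

lemma counit_iso:
  assumes x: "x \<in> Obj X"
  shows "is_iso X (\<epsilon> x)"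
proof -
  let ?y = "ob_map F (ob_map G x)"
  have o: "ob_map G x \<in> Obj C" "?y \<in> Obj X" using x G.ob_in F.ob_in by auto
  have full: "bij_betw (mor_map G) (hom X a b) (hom C (ob_map G a) (ob_map G b))"
    if "a \<in> Obj X" "b \<in> Obj X" for a b
    using localization that by (simp add: localization_def fully_faithful_def)
  \<comment> \<open>Fullness of \<open>G\<close> lifts the unit at \<open>ob_map G x\<close> to the
    prospective inverse of the counit. One equation follows from faithfulness of \<open>G\<close>
    and a triangle identity, the other from naturality of \<epsilon> at \<delta> and the other
    triangle.\<close>
  obtain \<delta> where \<delta>: "\<delta> \<in> hom X x ?y" "mor_map G \<delta> = \<eta> (ob_map G x)"
    using unit_in[OF o(1)] full[OF x o(2)] unfolding bij_betw_def by (metis imageE)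
  note e = counit_in[OF x]
  have "mor_map G (\<epsilon> x \<cdot>\<^bsub>X\<^esub> \<delta>) = mor_map G (Ident X x)"
    using G.map_comp[OF \<delta>(1) e] \<delta>(2) triangle_G[OF x] G.map_ident[OF x] by simp
  then have "\<epsilon> x \<cdot>\<^bsub>X\<^esub> \<delta> = Ident X x"
    using full[OF x x] F.target.comp_in[OF \<delta>(1) e] F.target.ident_in[OF x]
    unfolding bij_betw_def inj_on_def by blast
  moreover have "\<delta> \<cdot>\<^bsub>X\<^esub> \<epsilon> x = Ident X ?y"
    using counit_natural[OF \<delta>(1)] \<delta>(2) triangle_F[OF o(1)] by simp
  ultimately show ?thesis using F.target.is_isoI[OF e \<delta>(1)] by simp
qed

lemma F_unit_iso: "a \<in> Obj C \<Longrightarrow> is_iso X (mor_map F (\<eta> a))"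
  using F.target.inverse_is_iso'[OF counit_iso counit_in F.mor_in[OF unit_in]] triangle_F F.ob_in
  by blast

section \<open>Pullbacks, monomorphisms and essential monomorphisms under \<open>F\<close>\<close>

lemma F_pullback:
  "pullback C f g p q \<Longrightarrow> pullback X (mor_map F f) (mor_map F g) (mor_map F p) (mor_map F q)"
  using preserves_pullback[OF F.cat_functor_axioms] localization by (simp add: localization_def)

text \<open>Left exactness preserves trivial kernel pairs, hence monomorphisms; faithfulness
  reflects the equality of two parallel maps, hence monomorphisms.\<close>

lemma F_mono_iff:
  assumes m: "m \<in> hom C a b"
  shows "is_mono X (mor_map F m) \<longleftrightarrow> is_mono C m"
proof
  assume "is_mono C m"
  then have "pullback C m m (Ident C a) (Ident C a)"
    using F.source.is_mono_iff_pullback[OF m] by simp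
  from F_pullback[OF this] show "is_mono X (mor_map F m)"
    using F.target.is_mono_iff_pullback[OF F.mor_in[OF m]] F.map_ident F.source.homD[OF m] by simp
next
  assume mono: "is_mono X (mor_map F m)"
  show "is_mono C m"
  proof (rule F.source.is_monoI[OF m])
    fix x f g assume h: "f \<in> hom C x a" "g \<in> hom C x a" and eq: "m \<cdot>\<^bsub>C\<^esub> f = m \<cdot>\<^bsub>C\<^esub> g"
    have "mor_map F m \<cdot>\<^bsub>X\<^esub> mor_map F f = mor_map F m \<cdot>\<^bsub>X\<^esub> mor_map F g"
      using F.map_comp[OF h(1) m] F.map_comp[OF h(2) m] eq by simp
    then have "mor_map F f = mor_map F g"
      by (rule F.target.is_monoD[OF mono F.mor_in[OF m] F.mor_in[OF h(1)] F.mor_in[OF h(2)]])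
    then show "f = g"
      using faithful h F.source.homD[OF h(1)] unfolding faithful_def inj_on_def by blast
  qed
qed

text \<open>Being a monomorphism may be tested after applying \<open>F\<close>, and there
  precomposition with the isomorphism \<open>mor_map F m\<close> makes no difference.\<close>

lemma essential_of_F_iso:
  assumes m: "m \<in> Mor C" and iso: "is_iso X (mor_map F m)"
  shows "essential_mono C m"
proof -
  have h: "m \<in> hom C (Dom C m) (Cod C m)" using m by (simp add: hom_def)
  show ?thesis
  proof (rule F.source.essential_monoI[OF h])
    show "is_mono C m" using F_mono_iff[OF h] F.target.is_mono_iso[OF iso F.mor_in[OF h]] by simp
    fix c f assume f: "f \<in> hom C (Cod C m) c" "is_mono C (f \<cdot>\<^bsub>C\<^esub> m)"
    then have "is_mono X (mor_map F f \<cdot>\<^bsub>X\<^esub> mor_map F m)"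
      using F_mono_iff[OF F.source.comp_in[OF h f(1)]] F.map_comp[OF h f(1)] by simp
    then show "is_mono C f"
      using F.target.is_mono_comp_iso_iff[OF iso F.mor_in[OF h] F.mor_in[OF f(1)]]
        F_mono_iff[OF f(1)] by simp
  qed
qed

text \<open>\<open>F\<close> carries a pullback of \<open>m\<close> to a pullback of an isomorphism,
  so every projection of \<open>m\<close> is again inverted by \<open>F\<close>.\<close>

lemma pb_stable_essential_of_F_iso:
  assumes "m \<in> Mor C" "is_iso X (mor_map F m)"
  shows "pb_stable_essential_mono C m"
  unfolding pb_stable_essential_mono_def
proof (intro conjI allI impI essential_of_F_iso[OF assms])
  fix u p q assume pb: "pullback C m u p q"
  show "essential_mono C q"
    using essential_of_F_iso F.target.pullback_of_iso[OF F_pullback[OF pb] assms(2)] pb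
    by (simp add: pullback_def)
qed

text \<open>A map out of \<open>ob_map F b\<close> is replaced by its transpose, a map out of
  \<open>b\<close> to which essentiality of \<open>m\<close> applies. The invertible counit carries
  the conclusion back.\<close>

lemma F_essential:
  assumes ess: "essential_mono C m" and m: "m \<in> hom C a b"
  shows "essential_mono X (mor_map F m)"
proof (rule F.target.essential_monoI[OF F.mor_in[OF m]])
  show "is_mono X (mor_map F m)"
    using ess F_mono_iff[OF m] by (simp add: essential_mono_def)
  fix y f assume f: "f \<in> hom X (ob_map F b) y" and mono: "is_mono X (f \<cdot>\<^bsub>X\<^esub> mor_map F m)"
  have y: "y \<in> Obj X" and b: "b \<in> Obj C"
    using F.target.homD[OF f] F.source.homD[OF m] by auto
  \<comment> \<open>The transpose of \<open>f\<close>; the computation below recovers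
    \<open>f\<close> as \<open>\<epsilon> y \<cdot> mor_map F g\<close>.\<close>
  define g where "g = mor_map G f \<cdot>\<^bsub>C\<^esub> \<eta> b"
  have g: "g \<in> hom C b (ob_map G y)"
    unfolding g_def by (rule F.source.comp_in[OF unit_in[OF b] G.mor_in[OF f]])
  have Fb: "ob_map F b \<in> Obj X" using F.ob_in[OF b] .
  have "\<epsilon> y \<cdot>\<^bsub>X\<^esub> mor_map F g
      = \<epsilon> y \<cdot>\<^bsub>X\<^esub> mor_map F (mor_map G f) \<cdot>\<^bsub>X\<^esub> mor_map F (\<eta> b)"
    using F.target.comp_assoc[OF F.mor_in[OF unit_in[OF b]] F.mor_in[OF G.mor_in[OF f]]
        counit_in[OF y]] F.map_comp[OF unit_in[OF b] G.mor_in[OF f]] by (simp add: g_def)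
  also have "\<dots> = f"
    using counit_natural[OF f] triangle_F[OF b] F.target.ident_right[OF f]
      F.target.comp_assoc[OF F.mor_in[OF unit_in[OF b]] counit_in[OF Fb] f] by simp
  finally have eg: "\<epsilon> y \<cdot>\<^bsub>X\<^esub> mor_map F g = f" .
  have gm: "g \<cdot>\<^bsub>C\<^esub> m \<in> hom C a (ob_map G y)" by (rule F.source.comp_in[OF m g])
  have "\<epsilon> y \<cdot>\<^bsub>X\<^esub> mor_map F (g \<cdot>\<^bsub>C\<^esub> m) = f \<cdot>\<^bsub>X\<^esub> mor_map F m"
    using F.target.comp_assoc[OF F.mor_in[OF m] F.mor_in[OF g] counit_in[OF y]]
      F.map_comp[OF m g] eg by simp
  \<comment> \<open>\<open>mor_map F (g \<cdot> m)\<close> is the right factor of the monomorphism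
    \<open>f \<cdot> mor_map F m\<close>, and \<open>F\<close> reflects monomorphisms.\<close>
  then have "is_mono C (g \<cdot>\<^bsub>C\<^esub> m)"
    using F.target.is_mono_cancel[OF F.mor_in[OF gm] counit_in[OF y]] mono F_mono_iff[OF gm] by simp
  then have "is_mono C g" by (rule F.source.essential_monoD[OF ess m g])
  then have "is_mono X (mor_map F g)" using F_mono_iff[OF g] by simp
  then show "is_mono X f"
    using F.target.is_mono_comp[OF _ F.mor_in[OF g]
        F.target.is_mono_iso[OF counit_iso[OF y] counit_in[OF y]] counit_in[OF y]] eg by simp
qed

text \<open>Every \<open>u : y \<rightarrow> F b\<close> is isomorphic to the image of a morphism into \<open>b\<close>, namely of the
  pullback of \<open>G u\<close> along the unit, which \<open>F\<close> inverts.\<close>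

lemma lift_along_F:
  assumes u: "u \<in> hom X y (ob_map F b)" and b: "b \<in> Obj C"
  obtains d v e where "v \<in> hom C d b" "e \<in> hom X (ob_map F d) y" "is_iso X e"
    "mor_map F v = u \<cdot>\<^bsub>X\<^esub> e"
proof -
  have y: "y \<in> Obj X" using F.target.homD[OF u] by simp
  have Fb: "ob_map F b \<in> Obj X" using F.ob_in[OF b] .
  obtain v w where pb: "pullback C (\<eta> b) (mor_map G u) v w"
    using F.source.pullback_exists[OF limits unit_in[OF b] G.mor_in[OF u]] by metis
  obtain d where v: "v \<in> hom C d b" and w: "w \<in> hom C d (ob_map G y)"
    and eq: "\<eta> b \<cdot>\<^bsub>C\<^esub> v = mor_map G u \<cdot>\<^bsub>C\<^esub> w"
    using pb unit_in[OF b] G.mor_in[OF u] by (auto simp: hom_def dest!: F.source.pullback_homs)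
  have wiso: "is_iso X (mor_map F w)"
    by (rule F.target.pullback_of_iso[OF F_pullback[OF pb] F_unit_iso[OF b]])
  note Fw = F.mor_in[OF w] and ey = counit_in[OF y] and Fv = F.mor_in[OF v]
  \<comment> \<open>A triangle identity, the pullback square and naturality of \<epsilon> at
    \<open>u\<close> turn \<open>mor_map F v\<close> into \<open>u\<close> composed with
    \<open>\<epsilon> y \<cdot> mor_map F w\<close>, which is the required isomorphism
    \<open>e\<close>.\<close>
  have "mor_map F v = \<epsilon> (ob_map F b) \<cdot>\<^bsub>X\<^esub> mor_map F (\<eta> b) \<cdot>\<^bsub>X\<^esub> mor_map F v"
    using triangle_F[OF b] F.target.ident_left[OF Fv] by simp
  also have "\<dots> = \<epsilon> (ob_map F b) \<cdot>\<^bsub>X\<^esub> mor_map F (mor_map G u \<cdot>\<^bsub>C\<^esub> w)"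
    using F.target.comp_assoc[OF Fv F.mor_in[OF unit_in[OF b]] counit_in[OF Fb]]
      F.map_comp[OF v unit_in[OF b]] eq by simp
  also have "\<dots> = u \<cdot>\<^bsub>X\<^esub> \<epsilon> y \<cdot>\<^bsub>X\<^esub> mor_map F w"
    using F.target.comp_assoc[OF Fw F.mor_in[OF G.mor_in[OF u]] counit_in[OF Fb]]
      F.map_comp[OF w G.mor_in[OF u]] counit_natural[OF u] by simp
  also have "\<dots> = u \<cdot>\<^bsub>X\<^esub> (\<epsilon> y \<cdot>\<^bsub>X\<^esub> mor_map F w)"
    by (rule F.target.comp_assoc[OF Fw ey u])
  finally show ?thesis
    using that[OF v F.target.comp_in[OF Fw ey] F.target.is_iso_comp[OF wiso Fw counit_iso[OF y] ey]]
    by simp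
qed

text \<open>Up to an isomorphism \<open>e\<close>, a map \<open>u\<close> into
  \<open>ob_map F b\<close> is the image of some \<open>v\<close> in \<open>C\<close>. Pulling
  \<open>m\<close> back along \<open>v\<close> gives an essential monomorphism, whose image is
  essential and differs from the given projection only by isomorphisms.\<close>

lemma F_pb_stable_essential:
  assumes m: "pb_stable_essential_mono C m"
  shows "pb_stable_essential_mono X (mor_map F m)"
proof -
  define a b where "a = Dom C m" and "b = Cod C m"
  have ess: "essential_mono C m" and h: "m \<in> hom C a b"
    using m by (auto simp: pb_stable_essential_mono_def essential_mono_def is_mono_def hom_def a_def b_def)
  have b: "b \<in> Obj C" using F.source.homD[OF h] by simp
  show ?thesis
    unfolding pb_stable_essential_mono_def
  proof (intro conjI allI impI F_essential[OF ess h])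
    fix u p q assume pb: "pullback X (mor_map F m) u p q"
    obtain s t where u: "u \<in> hom X t (ob_map F b)" and q: "q \<in> hom X s t"
      using pb F.mor_in[OF h] by (auto simp: hom_def dest!: F.target.pullback_homs)
    obtain d v e where v: "v \<in> hom C d b" and e: "e \<in> hom X (ob_map F d) t" "is_iso X e"
      and Fv: "mor_map F v = u \<cdot>\<^bsub>X\<^esub> e"
      using lift_along_F[OF u b] by blast
    obtain p' q' where pb': "pullback C m v p' q'"
      using F.source.pullback_exists[OF limits h v] by metis
    obtain s' where q': "q' \<in> hom C s' d"
      using pb' v by (auto simp: hom_def dest!: F.source.pullback_homs)
    have "essential_mono C q'" using m pb' by (auto simp: pb_stable_essential_mono_def)
    then have "essential_mono X (e \<cdot>\<^bsub>X\<^esub> mor_map F q')"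
      using F.target.essential_mono_comp_iso[OF F_essential[OF _ q'] F.mor_in[OF q'] e(2,1)] by simp
    moreover have "pullback X (mor_map F m) u (mor_map F p') (e \<cdot>\<^bsub>X\<^esub> mor_map F q')"
      using F.target.pullback_along_iso[OF _ u e] F_pullback[OF pb'] Fv by simp
    then obtain k where "k \<in> hom X (ob_map F s') s" "is_iso X k" "q \<cdot>\<^bsub>X\<^esub> k = e \<cdot>\<^bsub>X\<^esub> mor_map F q'"
      using F.target.pullback_comparison[OF pb _ q F.target.comp_in[OF F.mor_in[OF q'] e(1)]]
      by metis
    ultimately show "essential_mono X q"
      using F.target.essential_mono_cancel_iso[OF q] by metis
  qed
qed

end

section \<open>Factorization through the category of fractions, and its quasi-inverse\<close>

theorem theorem5p1:
  fixes C :: "('o, 'm) cat" and X :: "('p, 'n) cat"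
    and F :: "('o, 'm, 'p, 'n) ftor" and G :: "('p, 'n, 'o, 'm) ftor"
    and \<eta> :: "'o \<Rightarrow> 'm" and \<epsilon> :: "'p \<Rightarrow> 'n"
  assumes "category C" and "has_finite_limits C" and "has_finite_colimits C"
    and "category X" and "has_finite_limits X" and "has_finite_colimits X"
    and "localization C X F G \<eta> \<epsilon>"
    and "faithful C X F"
    and "has_left_adjoint C X F"
    and "\<And>m. pb_stable_essential_mono X m \<Longrightarrow> is_iso X m"
  shows "\<exists>Fb. cat_functor (Spec C) X Fb \<and> ftor_eq C (Fb \<circ>\<^sub>F Spec_ftor C) F \<and>
           (\<forall>H. cat_functor (Spec C) X H \<and> ftor_eq C (H \<circ>\<^sub>F Spec_ftor C) F
              \<longrightarrow> ftor_eq (Spec C) H Fb) \<and>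
           equivalence (Spec C) X Fb"
proof -
  interpret faithful_localization C X F G \<eta> \<epsilon>
    using assms(2,7,8) by unfold_locales
  define S where "S = {m. pb_stable_essential_mono C m}"
  have S: "S \<subseteq> Mor C"
    by (auto simp: S_def pb_stable_essential_mono_def essential_mono_def is_mono_def)
  interpret fractions_setup C S
    using S by unfold_locales
  have Spec: "Spec C = Q" "Spec_ftor C = L"
    by (simp_all add: Spec_def Spec_ftor_def S_def)
  \<comment> \<open>The image of a member of \<open>S\<close> is a pullback stable essential
    monomorphism of \<open>X\<close>, and all of these are isomorphisms by hypothesis.\<close>
  have inv: "is_iso X (mor_map F s)" if "s \<in> S" for s
    using that assms(10) F_pb_stable_essential by (simp add: S_def)
  obtain Fb where Fb: "cat_functor Q X Fb" "ftor_eq C (Fb \<circ>\<^sub>F L) F"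
    and uniq: "\<forall>K. cat_functor Q X K \<and> ftor_eq C (K \<circ>\<^sub>F L) F \<longrightarrow> ftor_eq Q K Fb"
    using fractions_universal[OF F.cat_functor_axioms S inv] by metis
  interpret Fb: cat_functor Q X Fb by (rule Fb(1))
  interpret L: cat_functor C Q L by (rule functor_fractions)
  have ob: "ob_map Fb a = ob_map F a" if "a \<in> Obj C" for a
    using Fb(2) that by (simp add: ftor_eq_def comp_ftor_def)
  have mor: "mor_map Fb (mor_map L f) = mor_map F f" if "f \<in> Mor C" for f
    using Fb(2) that by (simp add: ftor_eq_def comp_ftor_def)
  have LG: "cat_functor X Q (L \<circ>\<^sub>F G)"
    by (rule functor_comp[OF G.cat_functor_axioms L.cat_functor_axioms])
  \<comment> \<open>The unit of the equivalence is the image of \<eta> in the category of fractions.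
    Its naturality has to be checked only on morphisms coming from \<open>C\<close>, where it is
    that of \<eta>.\<close>
  define \<tau> where "\<tau> a = mor_map L (\<eta> a)" for a
  have \<tau>: "\<tau> a \<in> hom Q a (ob_map G (ob_map F a))" if "a \<in> Obj C" for a
    using L.mor_in[OF unit_in[OF that]] by (simp add: \<tau>_def)
  have "nat_trans Q Q id_ftor ((L \<circ>\<^sub>F G) \<circ>\<^sub>F Fb) \<tau>"
  proof (rule nat_trans_fractionsI)
    show "cat_functor Q Q id_ftor" by (rule functor_id[OF category_fractions])
    show "cat_functor Q Q ((L \<circ>\<^sub>F G) \<circ>\<^sub>F Fb)" by (rule functor_comp[OF Fb(1) LG])
    fix a assume "a \<in> Obj C"
    then show "\<tau> a \<in> hom Q (ob_map id_ftor a) (ob_map ((L \<circ>\<^sub>F G) \<circ>\<^sub>F Fb) a)"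
      using \<tau> ob by (simp add: id_ftor_def comp_ftor_def)
  next
    fix f assume f: "f \<in> Mor C"
    then have h: "f \<in> hom C (Dom C f) (Cod C f)" by (simp add: hom_def)
    have o: "Dom C f \<in> Obj C" "Cod C f \<in> Obj C" using f by auto
    show "\<tau> (Cod C f) \<cdot>\<^bsub>Q\<^esub> mor_map id_ftor (mor_map L f)
        = mor_map ((L \<circ>\<^sub>F G) \<circ>\<^sub>F Fb) (mor_map L f) \<cdot>\<^bsub>Q\<^esub> \<tau> (Dom C f)"
      using L.map_comp[OF h unit_in[OF o(2)]] unit_natural[OF h]
        L.map_comp[OF unit_in[OF o(1)] G.mor_in[OF F.mor_in[OF h]]] mor[OF f]
      by (simp add: \<tau>_def id_ftor_def comp_ftor_def)
  qed
  \<comment> \<open>\<open>F\<close> inverts \<open>\<eta> a\<close>, so \<open>\<eta> a\<close>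
    lies in \<open>S\<close> and becomes invertible under \<open>L\<close>.\<close>
  moreover have "is_iso Q (\<tau> a)" if "a \<in> Obj C" for a
    unfolding \<tau>_def
    using iso_fractions pb_stable_essential_of_F_iso[OF _ F_unit_iso[OF that]]
      F.source.homD(1)[OF unit_in[OF that]] by (auto simp: S_def)
  ultimately have "nat_iso Q Q id_ftor ((L \<circ>\<^sub>F G) \<circ>\<^sub>F Fb) \<tau>"
    by (simp add: nat_iso_def)
  \<comment> \<open>On the values of \<open>G\<close>, \<open>Fb\<close> after \<open>L\<close>
    agrees with \<open>F\<close>, so the original counit serves unchanged.\<close>
  moreover have "nat_iso X X (Fb \<circ>\<^sub>F (L \<circ>\<^sub>F G)) id_ftor \<epsilon>"
    unfolding nat_iso_def nat_trans_def
  proof (intro conjI ballI)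
    show "cat_functor X X (Fb \<circ>\<^sub>F (L \<circ>\<^sub>F G))" by (rule functor_comp[OF LG Fb(1)])
    show "cat_functor X X id_ftor" by (rule functor_id[OF F.target.category_axioms])
    fix x assume x: "x \<in> Obj X"
    show "\<epsilon> x \<in> hom X (ob_map (Fb \<circ>\<^sub>F (L \<circ>\<^sub>F G)) x) (ob_map id_ftor x)"
      using counit_in[OF x] ob G.ob_in[OF x] by (simp add: comp_ftor_def id_ftor_def)
    show "is_iso X (\<epsilon> x)" by (rule counit_iso[OF x])
  next
    fix f assume "f \<in> Mor X"
    then have h: "f \<in> hom X (Dom X f) (Cod X f)" by (simp add: hom_def)
    show "\<epsilon> (Cod X f) \<cdot>\<^bsub>X\<^esub> mor_map (Fb \<circ>\<^sub>F (L \<circ>\<^sub>F G)) f = mor_map id_ftor f \<cdot>\<^bsub>X\<^esub> \<epsilon> (Dom X f)"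
      using counit_natural[OF h] mor F.source.homD[OF G.mor_in[OF h]]
      by (simp add: comp_ftor_def id_ftor_def)
  qed
  ultimately have "equivalence Q X Fb"
    using Fb(1) LG by (auto simp: equivalence_def)
  then show ?thesis
    using Fb uniq unfolding Spec by blast
qed

end
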